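(* Let $\theta^\star\in\Theta$ and $\xi>0$. Assume that $\lambda>0$, $\beta\in(0,1)$ and the event $B$ satisfy the Laplace-transform assumption at $\theta^\star$ (stated in the context). Then the posterior $\boldsymbol\pi_{\boldsymbol X}$ satisfies $$\mathbb E_B\left[\boldsymbol\pi_{\boldsymbol X}\left(\Theta\setminus\mathscr B(\theta^\star,2^Jr)\right)\right]\le 2e^{-\xi}\quad\text{with}\quad r=r(\boldsymbol\pi,\theta^\star)+\frac{A_0(\mathbf P^\star,B,\theta^\star)+1+\xi}{\gamma}.$$ That is, a randomised estimator $\widehat\theta$ with distribution $\boldsymbol\pi_{\boldsymbol X}$ (conditionally on $\boldsymbol X$) satisfies $$\mathbb P_B\left[2^{-J}\ell(\theta^\star,\widehat\theta)>r(\boldsymbol\pi,\theta^\star)+\gamma^{-1}\left(A_0(\mathbf P^\star,B,\theta^\star)+1+\xi\right)\right]\le 2e^{-\xi}.$$ In particular, if $\mathbb P(B)\ge 1-e^{-\xi}$, then $$\mathbb P\left[2^{-J}\ell(\theta^\star,\widehat\theta)>r(\boldsymbol\pi,\theta^\star)+\gamma^{-1}\left(A_0(\mathbf P^\star,B,\theta^\star)+1+\xi\right)\right]\le 3e^{-\xi}.$$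
   Context: Setting. $\boldsymbol X$ is a random variable from $(\Omega,\mathcal C)$ to a measurable space $(\mathbf E,\mathcal E)$ with distribution $\mathbf P^\star$ under the probability $\mathbb P$. $\Theta$ is a parameter set with a loss $\ell:\Theta^2\to[0,\infty)$ and a $\sigma$-algebra making all the balls $\mathscr B(\theta,r)=\{\theta'\in\Theta:\ \ell(\theta,\theta')\le r\}$ ($\theta\in\Theta$, $r\ge0$) measurable; $\boldsymbol\pi$ is a probability measure (prior) on $\Theta$. For an event $B\in\mathcal C$ with $\mathbb P(B)>0$, $\mathbb P_B,\mathbb E_B$ denote conditional probability and expectation given $B$. Test statistic: real-valued $\mathbf T(\boldsymbol X,\theta,\theta')$, measurable in $(\boldsymbol X,\theta,\theta')$, with $\mathbf T(\boldsymbol X,\theta,\theta')=-\mathbf T(\boldsymbol X,\theta',\theta)$. Posterior. For $\lambda>0$, $\beta\in(0,1)$ set $$\mathbf T(\boldsymbol X,\theta)=\int_\Theta \mathbf T(\boldsymbol X,\theta,\theta')\frac{\exp[\lambda\mathbf T(\boldsymbol X,\theta,\theta')]}{\int_\Theta\exp[\lambda\mathbf T(\boldsymbol X,\theta,\theta'')]d\boldsymbol\pi(\theta'')}d\boldsymbol\pi(\theta'),\qquad \frac{d\boldsymbol\pi_{\boldsymbol X}}{d\boldsymbol\pi}(\theta)=\frac{\exp[-\lambda(1-\beta)\mathbf T(\boldsymbol X,\theta)]}{\int_\Theta\exp[-\lambda(1-\beta)\mathbf T(\boldsymbol X,\theta')]d\boldsymbol\pi(\theta')}.$$ All integrals here are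 assumed to be well-defined and finite. The randomised estimator $\widehat\theta=\widehat\theta(\boldsymbol X,U)$ is built with an auxiliary random variable $U$ independent of all random variables on $(\Omega,\mathcal C)$, and its conditional distribution given $\boldsymbol X$ is $\boldsymbol\pi_{\boldsymbol X}$. Laplace-transform assumption at $\theta^\star$. For $\kappa>0$ and $\boldsymbol\theta=(\theta_1,\theta_2,\theta_3)\in\Theta^3$ put $\Delta_\kappa(\boldsymbol X,\boldsymbol\theta)=\kappa\mathbf T(\boldsymbol X,\theta_3,\theta_2)-\mathbf T(\boldsymbol X,\theta_3,\theta_1)$ and $\mathscr L_\kappa(\boldsymbol\theta,\lambda|B)=\mathbb E_B[\exp(\lambda\Delta_\kappa(\boldsymbol X,\boldsymbol\theta))]$. Let $\overline\beta=2-\beta$. The assumption is that $\mathbb P(B)>0$ and there are numbers $\mathfrak c_i(\lambda,\kappa)$, $i\in\{1,2,3\}$, $\kappa\in\{\beta,\overline\beta\}$, depending on $\lambda,\beta$, with $$\mathfrak c_1(\lambda,\beta)\wedge\mathfrak c_1(\lambda,\overline\beta)\ge0,\quad \mathfrak c_2(\lambda,\beta)\wedge\mathfrak c_2(\lambda,\overline\beta)>0,\quad \mathfrak c_3(\lambda,\overline\beta)\ge0,\quad \mathfrak c_3(\lambda,\beta)<0,$$ and nonnegative numbers $A_0(\lambda,\kappa,\mathbf P^\star,B,\theta^\star)$ such that for every $\boldsymbol\theta\in\Theta^3$ and $\kappa\in\{\beta,\overline\beta\}$ $$\mathscr L_\kappa(\boldsymbol\theta,\lambda|B)\le\exp\Big[A_0(\lambda,\kappa,\mathbf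 P^\star,B,\theta^\star)+\sum_{i=1}^3(-1)^{i-1}\mathfrak c_i(\lambda,\kappa)\ell(\theta^\star,\theta_i)\Big].$$ Constants: $\gamma=\frac13\left(\mathfrak c_2(\lambda,\beta)\wedge\mathfrak c_2(\lambda,\overline\beta)\wedge|\mathfrak c_3(\lambda,\beta)|\right)$; $J=2+\left\lceil\log_2\left(1+\frac{\mathfrak c_1(\lambda,\overline\beta)+\mathfrak c_1(\lambda,\beta)+\mathfrak c_3(\lambda,\overline\beta)}{2\gamma}\right)\right\rceil$; $A_0(\mathbf P^\star,B,\theta^\star)=\frac12\left(A_0(\lambda,\beta,\mathbf P^\star,B,\theta^\star)+A_0(\lambda,\overline\beta,\mathbf P^\star,B,\theta^\star)\right)$. Complexity: $r(\boldsymbol\pi,\theta)$ is the smallest nonnegative number such that $0<\boldsymbol\pi(\mathscr B(\theta,2r))\le e^{\gamma r}\boldsymbol\pi(\mathscr B(\theta,r))$ for every $r\ge r(\boldsymbol\pi,\theta)$. *)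

theory Defs
  imports "HOL-Probability.Probability"
begin

text \<open>The parameter set is \<^term>\<open>space \<pi>\<close>, where \<open>\<pi>\<close> is the prior. The conditional probability
  given an event \<open>B\<close> is \<^term>\<open>uniform_measure M B\<close>.\<close>

definition loss_ball :: "'t set \<Rightarrow> ('t \<Rightarrow> 't \<Rightarrow> real) \<Rightarrow> 't \<Rightarrow> real \<Rightarrow> 't set" where
  "loss_ball \<Theta> l \<theta> r = {\<theta>' \<in> \<Theta>. l \<theta> \<theta>' \<le> r}"

definition avg_test ::
  "'t measure \<Rightarrow> ('e \<Rightarrow> 't \<Rightarrow> 't \<Rightarrow> real) \<Rightarrow> real \<Rightarrow> 'e \<Rightarrow> 't \<Rightarrow> real" where
  "avg_test \<pi> T lam x \<theta> =
     (\<integral>\<theta>'. T x \<theta> \<theta>' * (exp (lam * T x \<theta> \<theta>') / (\<integral>\<theta>''. exp (lam * T x \<theta> \<theta>'') \<partial>\<pi>)) \<partial>\<pi>)"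

definition posterior ::
  "'t measure \<Rightarrow> ('e \<Rightarrow> 't \<Rightarrow> 't \<Rightarrow> real) \<Rightarrow> real \<Rightarrow> real \<Rightarrow> 'e \<Rightarrow> 't measure" where
  "posterior \<pi> T lam \<beta> x = density \<pi> (\<lambda>\<theta>. ennreal
     (exp (- lam * (1 - \<beta>) * avg_test \<pi> T lam x \<theta>) /
       (\<integral>\<theta>'. exp (- lam * (1 - \<beta>) * avg_test \<pi> T lam x \<theta>') \<partial>\<pi>)))"

text \<open>All integrals in the definition of the posterior at \<open>x\<close> are well defined and finite.\<close>

definition posterior_well_defined ::
  "'t measure \<Rightarrow> ('e \<Rightarrow> 't \<Rightarrow> 't \<Rightarrow> real) \<Rightarrow> real \<Rightarrow> real \<Rightarrow> 'e \<Rightarrow> bool" where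
  "posterior_well_defined \<pi> T lam \<beta> x \<longleftrightarrow>
     (\<forall>\<theta>\<in>space \<pi>.
        integrable \<pi> (\<lambda>\<theta>'. exp (lam * T x \<theta> \<theta>')) \<and>
        integrable \<pi> (\<lambda>\<theta>'. T x \<theta> \<theta>' * (exp (lam * T x \<theta> \<theta>') / (\<integral>\<theta>''. exp (lam * T x \<theta> \<theta>'') \<partial>\<pi>)))) \<and>
     integrable \<pi> (\<lambda>\<theta>. exp (- lam * (1 - \<beta>) * avg_test \<pi> T lam x \<theta>))"

text \<open>\<open>M\<close> is a probability space that carries the auxiliary variable \<open>U\<close>; the original
  \<open>\<sigma>\<close>-algebra of events is that of the subalgebra \<open>F\<close> of \<open>M\<close>, so ``independent of all random
  variables on the original space'' means independent of \<open>F\<close>. The last conjunct says that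
  \<open>K (X \<omega>)\<close> is the conditional distribution of the estimator given \<open>X\<close>.\<close>

definition randomised_estimator ::
  "'w measure \<Rightarrow> 'w measure \<Rightarrow> 'e measure \<Rightarrow> ('w \<Rightarrow> 'e) \<Rightarrow> 't measure \<Rightarrow> ('e \<Rightarrow> 't measure)
    \<Rightarrow> 'u measure \<Rightarrow> ('w \<Rightarrow> 'u) \<Rightarrow> ('e \<times> 'u \<Rightarrow> 't) \<Rightarrow> bool" where
  "randomised_estimator M F E X \<pi> K S U est \<longleftrightarrow>
     U \<in> measurable M S \<and>
     prob_space.indep_set M (sets F) (sets (vimage_algebra (space M) U S)) \<and>
     est \<in> measurable (E \<Otimes>\<^sub>M S) \<pi> \<and>
     (\<forall>C\<in>sets \<pi>. AE \<omega> in M.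
        real_cond_exp M (vimage_algebra (space M) X E) (\<lambda>\<omega>. indicator C (est (X \<omega>, U \<omega>))) \<omega>
          = measure (K (X \<omega>)) C)"

definition Delta :: "('e \<Rightarrow> 't \<Rightarrow> 't \<Rightarrow> real) \<Rightarrow> real \<Rightarrow> 'e \<Rightarrow> 't \<Rightarrow> 't \<Rightarrow> 't \<Rightarrow> real" where
  "Delta T \<kappa> x \<theta>1 \<theta>2 \<theta>3 = \<kappa> * T x \<theta>3 \<theta>2 - T x \<theta>3 \<theta>1"

text \<open>Valued in \<^typ>\<open>ennreal\<close>, so that an upper bound entails finiteness.\<close>

definition laplace ::
  "'w measure \<Rightarrow> ('w \<Rightarrow> 'e) \<Rightarrow> ('e \<Rightarrow> 't \<Rightarrow> 't \<Rightarrow> real) \<Rightarrow> 'w set \<Rightarrow> real \<Rightarrow> real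
    \<Rightarrow> 't \<Rightarrow> 't \<Rightarrow> 't \<Rightarrow> ennreal" where
  "laplace M X T B lam \<kappa> \<theta>1 \<theta>2 \<theta>3 =
     (\<integral>\<^sup>+\<omega>. ennreal (exp (lam * Delta T \<kappa> (X \<omega>) \<theta>1 \<theta>2 \<theta>3)) \<partial>uniform_measure M B)"

text \<open>\<open>c1\<close>, \<open>c2\<close>, \<open>c3\<close> and \<open>A0\<close> take \<open>lam\<close> and \<open>\<kappa>\<close> as arguments; only \<open>\<kappa> = \<beta>\<close> and
  \<open>\<kappa> = 2 - \<beta>\<close> matter.\<close>

definition laplace_assumption ::
  "'w measure \<Rightarrow> ('w \<Rightarrow> 'e) \<Rightarrow> 't set \<Rightarrow> ('t \<Rightarrow> 't \<Rightarrow> real) \<Rightarrow> ('e \<Rightarrow> 't \<Rightarrow> 't \<Rightarrow> real)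
    \<Rightarrow> 'w set \<Rightarrow> 't \<Rightarrow> real \<Rightarrow> real
    \<Rightarrow> (real \<Rightarrow> real \<Rightarrow> real) \<Rightarrow> (real \<Rightarrow> real \<Rightarrow> real) \<Rightarrow> (real \<Rightarrow> real \<Rightarrow> real)
    \<Rightarrow> (real \<Rightarrow> real \<Rightarrow> real) \<Rightarrow> bool" where
  "laplace_assumption M X \<Theta> l T B \<theta>s lam \<beta> c1 c2 c3 A0 \<longleftrightarrow>
     measure M B > 0 \<and>
     min (c1 lam \<beta>) (c1 lam (2 - \<beta>)) \<ge> 0 \<and>
     min (c2 lam \<beta>) (c2 lam (2 - \<beta>)) > 0 \<and>
     c3 lam (2 - \<beta>) \<ge> 0 \<and> c3 lam \<beta> < 0 \<and>
     (\<forall>\<kappa>\<in>{\<beta>, 2 - \<beta>}. A0 lam \<kappa> \<ge> 0) \<and>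
     (\<forall>\<theta>1\<in>\<Theta>. \<forall>\<theta>2\<in>\<Theta>. \<forall>\<theta>3\<in>\<Theta>. \<forall>\<kappa>\<in>{\<beta>, 2 - \<beta>}.
        laplace M X T B lam \<kappa> \<theta>1 \<theta>2 \<theta>3 \<le> ennreal (exp
          (A0 lam \<kappa> + (c1 lam \<kappa> * l \<theta>s \<theta>1 - c2 lam \<kappa> * l \<theta>s \<theta>2 + c3 lam \<kappa> * l \<theta>s \<theta>3))))"

definition gamma_const ::
  "(real \<Rightarrow> real \<Rightarrow> real) \<Rightarrow> (real \<Rightarrow> real \<Rightarrow> real) \<Rightarrow> real \<Rightarrow> real \<Rightarrow> real" where
  "gamma_const c2 c3 lam \<beta> = (1/3) * min (min (c2 lam \<beta>) (c2 lam (2 - \<beta>))) \<bar>c3 lam \<beta>\<bar>"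

definition J_const ::
  "(real \<Rightarrow> real \<Rightarrow> real) \<Rightarrow> (real \<Rightarrow> real \<Rightarrow> real) \<Rightarrow> (real \<Rightarrow> real \<Rightarrow> real) \<Rightarrow> real \<Rightarrow> real \<Rightarrow> int" where
  "J_const c1 c2 c3 lam \<beta> =
     2 + \<lceil>log 2 (1 + (c1 lam (2 - \<beta>) + c1 lam \<beta> + c3 lam (2 - \<beta>)) / (2 * gamma_const c2 c3 lam \<beta>))\<rceil>"

definition A0_avg :: "(real \<Rightarrow> real \<Rightarrow> real) \<Rightarrow> real \<Rightarrow> real \<Rightarrow> real" where
  "A0_avg A0 lam \<beta> = (1/2) * (A0 lam \<beta> + A0 lam (2 - \<beta>))"

definition complexity :: "'t measure \<Rightarrow> ('t \<Rightarrow> 't \<Rightarrow> real) \<Rightarrow> real \<Rightarrow> 't \<Rightarrow> real" where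
  "complexity \<pi> l \<gamma> \<theta> = (LEAST s. 0 \<le> s \<and> (\<forall>r\<ge>s.
     0 < measure \<pi> (loss_ball (space \<pi>) l \<theta> (2 * r)) \<and>
     measure \<pi> (loss_ball (space \<pi>) l \<theta> (2 * r))
       \<le> exp (\<gamma> * r) * measure \<pi> (loss_ball (space \<pi>) l \<theta> r)))"

end

theory Submission
  imports Defs
begin

text \<open>Write \<open>Z \<theta>\<close> for the \<open>\<pi>\<close>-integral of \<open>exp (lam * T x \<theta> \<theta>')\<close> over \<open>\<theta>'\<close> and \<open>V\<close> for the ball of
  radius \<open>r\<close> around \<open>\<theta>s\<close>. The averaged statistic is the derivative at \<open>lam\<close> of the cumulant
  generating function of \<open>T x \<theta>\<close> under the prior, so convexity gives, for \<open>\<kappa> = \<beta>\<close> and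
  \<open>\<kappa> = 2 - \<beta>\<close>, the bound
  \<open>exp (lam * (\<kappa> - 1) * avg_test \<theta>) \<le> (\<integral> exp (lam * \<kappa> * T x \<theta> \<theta>2) d\<theta>2) / Z \<theta>\<close>. Convexity of
  the inverse bounds \<open>1 / Z \<theta>\<close> by \<open>1 / \<pi>(V)\<^sup>2\<close> times the integral of \<open>exp (- lam * T x \<theta> \<theta>1)\<close> over
  \<open>\<theta>1\<close> in \<open>V\<close>. The product of the two is an integral of \<open>exp (lam * Delta T \<kappa> x \<theta>1 \<theta>2 \<theta>)\<close>, whose
  expectation is controlled by the Laplace assumption after an exchange of integrals
  (\<open>expected_exp_avg_test_le_loss\<close>).

  The posterior mass of the complement \<open>C\<close> of the ball of radius \<open>2^J * r\<close> is a quotient \<open>R / D\<close>,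
  where \<open>R\<close> is the integral over \<open>C\<close> and \<open>D\<close> the integral over the whole space. The case
  \<open>\<kappa> = \<beta>\<close> bounds the expectation of \<open>R\<close>. The case \<open>\<kappa> = 2 - \<beta>\<close> bounds that of \<open>1 / D\<close>, again by
  convexity of the inverse on \<open>V\<close>. Since \<open>R / D \<le> 1\<close>, the quotient is at most the square root of
  \<open>R * (1 / D)\<close>, hence at most \<open>(t * R + (1 / D) / t) / 2\<close> for every \<open>t > 0\<close>, which separates the
  two expectations (\<open>emeasure_posterior_le\<close>). This is why the average of the two constants \<open>A0\<close>
  appears in the radius.

  The remaining integrals of \<open>exp (- c * l \<theta>s \<theta>)\<close> with \<open>c \<ge> 3 * \<gamma>\<close> are cut into the shells between
  the radii \<open>2^j * r\<close> and \<open>2^(j+1) * r\<close>, whose masses are controlled by the complexity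
  (\<open>tail_exp_integral_le\<close>); for this, the smallest number defining the complexity has to exist
  (\<open>complexity_props\<close>). The choice of \<open>J\<close> makes the resulting factor \<open>exp (- \<gamma> * r * 2^J)\<close> absorb the
  factors \<open>exp (c * r)\<close> coming from the points of \<open>V\<close>.

  Finally, a randomised estimator has conditional law \<open>posterior\<close> not only
  given \<open>X\<close> but given the whole original \<open>\<sigma>\<close>-algebra (\<open>emeasure_randomised_estimator\<close>), so its
  deviation probability given \<open>B\<close> is exactly the expected posterior mass.\<close>

section \<open>Two integral inequalities\<close>

lemma (in prob_space) exp_expectation_le_nn_integral:
  fixes f :: "'a \<Rightarrow> real"
  assumes [measurable]: "integrable M f"
  shows "ennreal (exp (expectation f)) \<le> (\<integral>\<^sup>+x. ennreal (exp (f x)) \<partial>M)"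
proof -
  let ?m = "expectation f"
  \<comment> \<open>tangent line of \<open>exp\<close> at the mean; the right-hand side may be infinite\<close>
  let ?g = "\<lambda>x. exp ?m * (1 + (f x - ?m))"
  have g: "integrable M ?g" using assms by auto
  have "expectation ?g = exp ?m" using assms by (simp add: prob_space)
  moreover have "expectation ?g \<le> enn2real (\<integral>\<^sup>+x. ennreal (?g x) \<partial>M)"
    by (subst real_lebesgue_integral_def[OF g]) simp
  moreover have "(\<integral>\<^sup>+x. ennreal (?g x) \<partial>M) < top"
    using g unfolding real_integrable_def less_top[symmetric] infinity_ennreal_def by blast
  ultimately have "ennreal (exp ?m) \<le> (\<integral>\<^sup>+x. ennreal (?g x) \<partial>M)"
    by (metis ennreal_enn2real ennreal_leI)
  also have "\<dots> \<le> (\<integral>\<^sup>+x. ennreal (exp (f x)) \<partial>M)"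
  proof (intro nn_integral_mono ennreal_leI)
    fix x
    have "?g x \<le> exp ?m * exp (f x - ?m)"
      by (intro mult_left_mono exp_ge_add_one_self) auto
    then show "?g x \<le> exp (f x)" by (simp add: exp_add[symmetric])
  qed
  finally show ?thesis .
qed

text \<open>Convexity of the inverse, for the normalised restriction of the measure to \<open>V\<close>.\<close>

lemma (in finite_measure) inverse_le_nn_integral_inverse:
  fixes f :: "'a \<Rightarrow> real"
  assumes [measurable]: "f \<in> borel_measurable M" "V \<in> sets M"
    and pos: "\<And>x. x \<in> space M \<Longrightarrow> 0 < f x" and V: "0 < measure M V" and F: "0 < F"
    and le: "(\<integral>\<^sup>+x\<in>V. ennreal (f x) \<partial>M) \<le> ennreal F"
  shows "ennreal (1 / F) \<le> ennreal (1 / (measure M V)\<^sup>2) * (\<integral>\<^sup>+x\<in>V. ennreal (1 / f x) \<partial>M)"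
proof -
  define p where "p = measure M V"
  \<comment> \<open>\<open>2 \<le> f / a + a / f\<close> is integrated over \<open>V\<close> with \<open>a\<close> the bound on the mean of \<open>f\<close> there\<close>
  define a where "a = F / p"
  define I where "I = (\<integral>\<^sup>+x\<in>V. ennreal (1 / f x) \<partial>M)"
  have p: "0 < p" and a: "0 < a" using V F by (auto simp: p_def a_def)
  have "ennreal p + ennreal p = (\<integral>\<^sup>+x\<in>V. ennreal 2 \<partial>M)"
    using p by (simp add: nn_integral_cmult_indicator emeasure_eq_measure p_def
        ennreal_plus[symmetric] ennreal_mult'[symmetric] del: ennreal_plus ennreal_numeral)
  also have "\<dots> \<le> (\<integral>\<^sup>+x. ennreal (1/a) * (ennreal (f x) * indicator V x)
      + ennreal a * (ennreal (1 / f x) * indicator V x) \<partial>M)"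
  proof (intro nn_integral_mono)
    fix x assume x: "x \<in> space M"
    have "0 \<le> (f x - a)\<^sup>2" by simp
    then have "2 \<le> (1/a) * f x + a * (1 / f x)"
      using pos[OF x] a by (simp add: field_simps power2_eq_square)
    then have "ennreal 2 \<le> ennreal (1/a) * ennreal (f x) + ennreal a * ennreal (1 / f x)"
      using pos[OF x] a
      by (simp add: ennreal_mult'[symmetric] ennreal_plus[symmetric] ennreal_leI
          del: ennreal_plus ennreal_numeral)
    then show "ennreal 2 * indicator V x \<le> ennreal (1/a) * (ennreal (f x) * indicator V x)
      + ennreal a * (ennreal (1 / f x) * indicator V x)"
      by (auto split: split_indicator)
  qed
  also have "\<dots> = ennreal (1/a) * (\<integral>\<^sup>+x\<in>V. ennreal (f x) \<partial>M) + ennreal a * I"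
    unfolding I_def by (subst nn_integral_add) (auto simp: nn_integral_cmult)
  also have "\<dots> \<le> ennreal (1/a) * ennreal F + ennreal a * I"
    by (intro add_mono mult_left_mono le) auto
  also have "ennreal (1/a) * ennreal F = ennreal p"
    using a p F by (simp add: ennreal_mult'[symmetric] a_def)
  finally have *: "ennreal p \<le> ennreal a * I"
    by (simp add: ennreal_add_left_cancel_le)
  have "ennreal (1 / F) = ennreal (1 / (a * p\<^sup>2)) * ennreal p"
    using a p F by (simp add: ennreal_mult'[symmetric] a_def power2_eq_square field_simps)
  also have "\<dots> \<le> ennreal (1 / (a * p\<^sup>2)) * (ennreal a * I)"
    by (intro mult_left_mono *) auto
  also have "\<dots> = ennreal (1 / (a * p\<^sup>2) * a) * I"
    using a p by (simp only: ennreal_mult'' mult.assoc less_imp_le)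
  also have "1 / (a * p\<^sup>2) * a = 1 / p\<^sup>2" using a by simp
  finally show ?thesis by (simp add: p_def I_def)
qed

section \<open>Prior mass of the balls around a point\<close>

text \<open>The prior \<open>\<pi>\<close> together with the loss \<open>l \<theta>s\<close> from a fixed point \<open>\<theta>s\<close> and the rate \<open>\<gamma>\<close> of
  the complexity.\<close>

locale centred_prior = prob_space \<pi> for \<pi> :: "'t measure" +
  fixes l :: "'t \<Rightarrow> 't \<Rightarrow> real" and \<theta>s :: 't and \<gamma> :: real
  assumes loss_nonneg: "\<And>\<theta>. \<theta> \<in> space \<pi> \<Longrightarrow> 0 \<le> l \<theta>s \<theta>"
    and ball_sets: "\<And>\<rho>. 0 \<le> \<rho> \<Longrightarrow> loss_ball (space \<pi>) l \<theta>s \<rho> \<in> sets \<pi>"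
    and rate_pos: "0 < \<gamma>"
begin

text \<open>The prior mass of the closed ball of radius \<open>\<rho>\<close> around \<open>\<theta>s\<close>; it vanishes for \<open>\<rho> < 0\<close>.\<close>

definition ball_mass :: "real \<Rightarrow> real" where
  "ball_mass \<rho> = prob (loss_ball (space \<pi>) l \<theta>s \<rho>)"

lemma loss_measurable [measurable]: "l \<theta>s \<in> borel_measurable \<pi>"
  unfolding borel_measurable_iff_le
proof
  fix a :: real
  show "{w \<in> space \<pi>. l \<theta>s w \<le> a} \<in> sets \<pi>"
  proof (cases "0 \<le> a")
    case True then show ?thesis using ball_sets[of a] by (simp add: loss_ball_def)
  next
    case False
    then have "{w \<in> space \<pi>. l \<theta>s w \<le> a} = {}"
      using loss_nonneg by (auto simp: not_le intro: less_le_trans)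
    then show ?thesis by (simp only: sets.empty_sets)
  qed
qed

lemma ball_measurable [measurable]: "loss_ball (space \<pi>) l \<theta>s \<rho> \<in> sets \<pi>"
  unfolding loss_ball_def by measurable

lemma emeasure_ball: "emeasure \<pi> (loss_ball (space \<pi>) l \<theta>s \<rho>) = ennreal (ball_mass \<rho>)"
  by (simp add: ball_mass_def emeasure_eq_measure)

lemma ball_mass_mono: "\<rho> \<le> \<rho>' \<Longrightarrow> ball_mass \<rho> \<le> ball_mass \<rho>'"
  unfolding ball_mass_def by (intro finite_measure_mono) (auto simp: loss_ball_def)

lemma ball_mass_nonneg: "0 \<le> ball_mass \<rho>"
  by (simp add: ball_mass_def)

lemma ball_mass_eq_cdf: "ball_mass = cdf (distr \<pi> borel (l \<theta>s))"
  by (auto simp: ball_mass_def cdf_def measure_distr loss_ball_def vimage_def Int_def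
      intro!: ext arg_cong[where f="measure \<pi>"])

lemma ball_mass_at_right: "(ball_mass \<longlongrightarrow> ball_mass a) (at_right a)"
  and ball_mass_at_top: "(ball_mass \<longlongrightarrow> 1) at_top"
proof -
  interpret D: real_distribution "distr \<pi> borel (l \<theta>s)"
    by (intro real_distribution_distr) simp
  show "(ball_mass \<longlongrightarrow> ball_mass a) (at_right a)"
    using D.cdf_is_right_cont[of a] by (simp add: continuous_within ball_mass_eq_cdf)
  show "(ball_mass \<longlongrightarrow> 1) at_top"
    using D.cdf_lim_at_top_prob by (simp add: ball_mass_eq_cdf)
qed

text \<open>The doubling condition at radius \<open>\<rho>\<close>; the complexity is the smallest nonnegative number
  from which on it holds.\<close>

definition doubling_at :: "real \<Rightarrow> bool" where
  "doubling_at \<rho> \<longleftrightarrow> 0 < ball_mass (2 * \<rho>) \<and> ball_mass (2 * \<rho>) \<le> exp (\<gamma> * \<rho>) * ball_mass \<rho>"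

lemma complexity_eq: "complexity \<pi> l \<gamma> \<theta>s = (LEAST s. 0 \<le> s \<and> (\<forall>\<rho>\<ge>s. doubling_at \<rho>))"
  by (simp add: complexity_def doubling_at_def ball_mass_def)

lemma eventually_doubling: "\<exists>s\<ge>0. \<forall>\<rho>\<ge>s. doubling_at \<rho>"
proof -
  have "eventually (\<lambda>\<rho>. 1/2 < ball_mass \<rho>) at_top"
    using order_tendstoD(1)[OF ball_mass_at_top, of "1/2"] by simp
  then obtain s where s: "\<And>\<rho>. s \<le> \<rho> \<Longrightarrow> 1/2 < ball_mass \<rho>"
    by (auto simp: eventually_at_top_linorder)
  show ?thesis
  proof (intro exI[of _ "max (max s 0) (1/\<gamma>)"] conjI allI impI)
    fix \<rho> assume "max (max s 0) (1/\<gamma>) \<le> \<rho>"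
    then have \<rho>: "s \<le> \<rho>" "0 \<le> \<rho>" "1/\<gamma> \<le> \<rho>" by auto
    then have "1 \<le> \<gamma> * \<rho>" using rate_pos by (simp add: field_simps)
    then have "2 \<le> exp (\<gamma> * \<rho>)" using exp_ge_add_one_self[of "\<gamma> * \<rho>"] by linarith
    then have "2 * (1/2) \<le> exp (\<gamma> * \<rho>) * ball_mass \<rho>"
      using s[OF \<rho>(1)] by (intro mult_mono) auto
    moreover have "ball_mass (2*\<rho>) \<le> 1" by (simp add: ball_mass_def)
    moreover have "0 < ball_mass (2*\<rho>)" using s[of "2*\<rho>"] \<rho> by simp
    ultimately show "doubling_at \<rho>" unfolding doubling_at_def by linarith
  qed auto
qed

text \<open>If the doubling condition holds at all positive radii, the centre itself is charged.\<close>

lemma ball_mass_0_pos: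
  assumes "\<And>\<rho>. 0 < \<rho> \<Longrightarrow> doubling_at \<rho>"
  shows "0 < ball_mass 0"
proof -
  have iter: "ball_mass \<rho> \<le> exp (\<gamma> * \<rho> * (1 - 1/2^n)) * ball_mass (\<rho> / 2^n)" if "0 < \<rho>" for \<rho> n
  proof (induction n)
    case (Suc n)
    have "ball_mass (\<rho> / 2^n) \<le> exp (\<gamma> * (\<rho> / 2^Suc n)) * ball_mass (\<rho> / 2^Suc n)"
      using assms[of "\<rho> / 2^Suc n"] that by (simp add: doubling_at_def)
    then have "ball_mass \<rho> \<le> exp (\<gamma> * \<rho> * (1 - 1/2^n)) *
        (exp (\<gamma> * (\<rho> / 2^Suc n)) * ball_mass (\<rho> / 2^Suc n))"
      by (rule order_trans[OF Suc mult_left_mono]) simp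
    also have "\<dots> = exp (\<gamma> * \<rho> * (1 - 1/2^n) + \<gamma> * (\<rho> / 2^Suc n)) * ball_mass (\<rho> / 2^Suc n)"
      by (simp only: exp_add mult.assoc)
    also have "\<gamma> * \<rho> * (1 - 1/2^n) + \<gamma> * (\<rho> / 2^Suc n) = \<gamma> * \<rho> * (1 - 1/2^Suc n)"
      by (simp add: field_simps)
    finally show ?case .
  qed simp
  \<comment> \<open>the factors of the successive halvings multiply to at most \<open>exp \<gamma>\<close>\<close>
  have *: "ball_mass 1 \<le> exp \<gamma> * ball_mass (1 / 2^n)" for n
  proof -
    have "exp (\<gamma> * (1 - 1/2^n)) \<le> exp \<gamma>" using rate_pos by (simp add: field_simps)
    then have "exp (\<gamma> * (1 - 1/2^n)) * ball_mass (1/2^n) \<le> exp \<gamma> * ball_mass (1/2^n)"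
      by (intro mult_right_mono ball_mass_nonneg)
    then show ?thesis using iter[of 1 n] by simp
  qed
  have "(\<lambda>n. (1/2::real)^n) \<longlonglongrightarrow> 0" by (intro LIMSEQ_power_zero) simp
  then have "filterlim (\<lambda>n. 1 / 2^n :: real) (at_right 0) sequentially"
    by (auto simp: filterlim_at power_one_over)
  from filterlim_compose[OF ball_mass_at_right this]
  have "ball_mass 1 \<le> exp \<gamma> * ball_mass 0"
    by (intro tendsto_lowerbound[OF tendsto_mult[OF tendsto_const]]) (auto simp: *)
  moreover have "0 < ball_mass 1" using assms[of "1/2"] by (simp add: doubling_at_def)
  ultimately have "0 < exp \<gamma> * ball_mass 0" by (rule less_le_trans[rotated])
  then show ?thesis by (simp add: zero_less_mult_iff)
qed

text \<open>The smallest number in the definition of the complexity exists: right-continuity of the mass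
  passes the doubling condition on to the infimum.\<close>

lemma complexity_props: "0 \<le> complexity \<pi> l \<gamma> \<theta>s \<and> (\<forall>\<rho>\<ge>complexity \<pi> l \<gamma> \<theta>s. doubling_at \<rho>)"
proof -
  define S where "S = {s. 0 \<le> s \<and> (\<forall>\<rho>\<ge>s. doubling_at \<rho>)}"
  define s0 where "s0 = Inf S"
  have S: "S \<noteq> {}" using eventually_doubling by (auto simp: S_def)
  have bdd: "bdd_below S" by (auto simp: S_def bdd_below_def)
  have s0: "0 \<le> s0" unfolding s0_def by (rule cInf_greatest[OF S]) (auto simp: S_def)
  have above: "doubling_at \<rho>" if "s0 < \<rho>" for \<rho>
  proof -
    have "\<exists>s\<in>S. s < \<rho>" using that cInf_less_iff[OF S bdd, of \<rho>] by (simp add: s0_def)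
    then show ?thesis by (auto simp: S_def)
  qed
  have "doubling_at s0"
    unfolding doubling_at_def
  proof
    show "0 < ball_mass (2 * s0)"
    proof (cases "s0 = 0")
      case True then show ?thesis using ball_mass_0_pos above by simp
    next
      case False
      then have d: "doubling_at (2 * s0)" using s0 by (intro above) simp
      show ?thesis
      proof (rule ccontr)
        assume "\<not> 0 < ball_mass (2 * s0)"
        then have "ball_mass (2 * s0) = 0" using ball_mass_nonneg[of "2 * s0"] by simp
        then show False using d by (auto simp: doubling_at_def)
      qed
    qed
    have "((\<lambda>\<rho>. exp (\<gamma> * \<rho>) * ball_mass \<rho>) \<longlongrightarrow> exp (\<gamma> * s0) * ball_mass s0) (at_right s0)"
      by (intro tendsto_intros ball_mass_at_right)
    moreover have "eventually (\<lambda>\<rho>. ball_mass (2 * s0) \<le> exp (\<gamma> * \<rho>) * ball_mass \<rho>) (at_right s0)"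
      unfolding eventually_at_filter
    proof (rule always_eventually, intro allI impI)
      fix \<rho> assume "\<rho> \<in> {s0<..}"
      then have "ball_mass (2 * s0) \<le> ball_mass (2 * \<rho>)" "doubling_at \<rho>"
        by (auto intro!: ball_mass_mono above)
      then show "ball_mass (2 * s0) \<le> exp (\<gamma> * \<rho>) * ball_mass \<rho>"
        by (simp add: doubling_at_def)
    qed
    ultimately show "ball_mass (2 * s0) \<le> exp (\<gamma> * s0) * ball_mass s0"
      by (intro tendsto_lowerbound) auto
  qed
  then have mem: "0 \<le> s0 \<and> (\<forall>\<rho>\<ge>s0. doubling_at \<rho>)"
    using s0 above by (auto simp: le_less)
  have "complexity \<pi> l \<gamma> \<theta>s = s0"
    unfolding complexity_eq
  proof (rule Least_equality)
    show "0 \<le> s0 \<and> (\<forall>\<rho>\<ge>s0. doubling_at \<rho>)" by (rule mem)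
    show "s0 \<le> s" if "0 \<le> s \<and> (\<forall>\<rho>\<ge>s. doubling_at \<rho>)" for s
      unfolding s0_def using that by (intro cInf_lower bdd) (simp add: S_def)
  qed
  with mem show ?thesis by simp
qed

lemma complexity_nonneg: "0 \<le> complexity \<pi> l \<gamma> \<theta>s"
  using complexity_props by blast

context
  fixes r :: real
  assumes r: "complexity \<pi> l \<gamma> \<theta>s \<le> r"
begin

lemma ball_mass_pos: "0 < ball_mass r"
proof (rule ccontr)
  assume "\<not> 0 < ball_mass r"
  then have "ball_mass r = 0" using ball_mass_nonneg[of r] by simp
  moreover have "doubling_at r" using complexity_props r by blast
  ultimately show False by (auto simp: doubling_at_def)
qed

lemma ball_mass_power2_le: "ball_mass (2^j * r) \<le> exp (\<gamma> * r * (2^j - 1)) * ball_mass r"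
proof (induction j)
  case (Suc j)
  have "0 \<le> r" using complexity_nonneg r by simp
  then have "1 * r \<le> 2^j * r" by (intro mult_right_mono) simp_all
  then have "doubling_at (2^j * r)" using complexity_props r by simp
  then have "ball_mass (2^Suc j * r) \<le> exp (\<gamma> * (2^j * r)) * ball_mass (2^j * r)"
    by (simp add: doubling_at_def mult.assoc)
  also have "\<dots> \<le> exp (\<gamma> * (2^j * r)) * (exp (\<gamma> * r * (2^j - 1)) * ball_mass r)"
    by (intro mult_left_mono Suc) simp
  also have "\<dots> = exp (\<gamma> * (2^j * r) + \<gamma> * r * (2^j - 1)) * ball_mass r"
    by (simp only: exp_add mult.assoc)
  also have "\<gamma> * (2^j * r) + \<gamma> * r * (2^j - 1) = \<gamma> * r * (2^Suc j - 1)"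
    by (simp add: algebra_simps)
  finally show ?case .
qed simp

text \<open>Since \<open>c \<ge> 3 * \<gamma>\<close>, slicing along the radii \<open>2^j * r\<close> leaves a rate of at
  least \<open>\<gamma>\<close> after the growth of the mass, which uses up \<open>2 * \<gamma>\<close>.\<close>

lemma tail_exp_integral_le:
  assumes c: "3 * \<gamma> \<le> c" and one: "1 \<le> \<gamma> * r"
  shows "(\<integral>\<^sup>+\<theta>\<in>space \<pi> - loss_ball (space \<pi>) l \<theta>s (2^n * r). ennreal (exp (- c * l \<theta>s \<theta>)) \<partial>\<pi>)
    \<le> ennreal (2 * exp (- \<gamma> * r * (1 + 2^n)) * ball_mass r)"
    (is "?I \<le> _")
proof -
  let ?a = "\<lambda>k. exp (- c * (2^(n+k) * r))"
  let ?B = "\<lambda>k. loss_ball (space \<pi>) l \<theta>s (2^(n+k+1) * r)"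
  let ?q = "exp (- \<gamma> * r)"
  let ?C = "exp (- \<gamma> * r * (1 + 2^n)) * ball_mass r"
  have "0 < \<gamma> * r" using one by (rule less_le_trans[OF zero_less_one])
  then have r0: "0 < r" using rate_pos by (rule zero_less_mult_pos)
  have c0: "0 \<le> c" using c rate_pos by simp
  have q: "?q \<le> 1/2"
  proof -
    have "2 \<le> exp (\<gamma> * r)" using exp_ge_add_one_self[of "\<gamma> * r"] one by linarith
    then show ?thesis by (simp add: exp_minus field_simps)
  qed
  have "?I \<le> (\<integral>\<^sup>+\<theta>. (\<Sum>k. ennreal (?a k) * indicator (?B k) \<theta>) \<partial>\<pi>)"
  proof (intro nn_integral_mono)
    fix \<theta> assume \<theta>: "\<theta> \<in> space \<pi>"
    show "ennreal (exp (- c * l \<theta>s \<theta>)) * indicator (space \<pi> - loss_ball (space \<pi>) l \<theta>s (2^n * r)) \<theta>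
      \<le> (\<Sum>k. ennreal (?a k) * indicator (?B k) \<theta>)"
    proof (cases "2^n * r < l \<theta>s \<theta>")
      case False
      then have "\<theta> \<in> loss_ball (space \<pi>) l \<theta>s (2^n * r)" using \<theta> by (simp add: loss_ball_def)
      then show ?thesis by simp
    next
      case True
      let ?f = "\<lambda>k. ennreal (?a k) * indicator (?B k) \<theta>"
      have "\<exists>k. l \<theta>s \<theta> \<le> 2^(n+k+1) * r"
      proof -
        obtain k where "l \<theta>s \<theta> / r < 2^k" using real_arch_pow[of 2 "l \<theta>s \<theta> / r"] by auto
        also have "(2::real)^k \<le> 2^(n+k+1)" by (intro power_increasing) auto
        finally show ?thesis using r0 by (auto simp: field_simps intro: less_imp_le)
      qed
      \<comment> \<open>the first such \<open>k\<close> gives the slice that contains \<open>\<theta>\<close>\<close>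
      then obtain k where k: "l \<theta>s \<theta> \<le> 2^(n+k+1) * r" "\<And>i. i < k \<Longrightarrow> \<not> l \<theta>s \<theta> \<le> 2^(n+i+1) * r"
        using exists_least_iff[of "\<lambda>k. l \<theta>s \<theta> \<le> 2^(n+k+1) * r"] by blast
      have "2^(n+k) * r \<le> l \<theta>s \<theta>"
      proof (cases k)
        case 0 then show ?thesis using True by simp
      next
        case (Suc i) then show ?thesis using k(2)[of i] by simp
      qed
      then have "- c * l \<theta>s \<theta> \<le> - c * (2^(n+k) * r)"
        using c0 by (simp add: mult_left_mono)
      then have "ennreal (exp (- c * l \<theta>s \<theta>)) \<le> ?f k"
        using k(1) \<theta> by (simp add: loss_ball_def ennreal_leI)
      also have "?f k = sum ?f {k}" by (simp only: sum.insert finite.emptyI sum.empty empty_iff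
            not_False_eq_True add_0_right)
      also have "\<dots> \<le> (\<Sum>k. ?f k)" by (rule sum_le_suminf) auto
      finally show ?thesis using True \<theta> by (simp add: loss_ball_def)
    qed
  qed
  also have "\<dots> = (\<Sum>k. ennreal (?a k * ball_mass (2^(n+k+1) * r)))"
    by (simp add: nn_integral_suminf nn_integral_cmult_indicator emeasure_ball ennreal_mult'
        ball_mass_nonneg del: power_Suc)
  also have "\<dots> \<le> (\<Sum>k. ennreal (?C * ?q^k))"
  proof (intro suminf_le ennreal_leI)
    fix k
    have "?a k * ball_mass (2^(n+k+1) * r) \<le>
        exp (- 3 * \<gamma> * (2^(n+k) * r)) * (exp (\<gamma> * r * (2^(n+k+1) - 1)) * ball_mass r)"
    proof (intro mult_mono ball_mass_power2_le ball_mass_nonneg)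
      have "3 * \<gamma> * (2^(n+k) * r) \<le> c * (2^(n+k) * r)"
        using c r0 by (intro mult_right_mono) auto
      then show "?a k \<le> exp (- 3 * \<gamma> * (2^(n+k) * r))" by simp
    qed auto
    also have "\<dots> = exp (- 3 * \<gamma> * (2^(n+k) * r) + \<gamma> * r * (2^(n+k+1) - 1)) * ball_mass r"
      by (simp only: exp_add mult.assoc)
    also have "- 3 * \<gamma> * (2^(n+k) * r) + \<gamma> * r * (2^(n+k+1) - 1) = - \<gamma> * r * (1 + 2^(n+k))"
      by (simp add: algebra_simps)
    also have "exp (- \<gamma> * r * (1 + 2^(n+k))) * ball_mass r
        \<le> exp (- \<gamma> * r * (1 + 2^n) + real k * (- \<gamma> * r)) * ball_mass r"
    proof -
      have "2^n + real k \<le> 2^n * 2^k"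
      proof -
        have "(2::real)^k - 1 \<le> 2^n * (2^k - 1)"
          using mult_right_mono[of 1 "2^n::real" "2^k - 1"] by simp
        moreover have "real k \<le> 2^k - 1"
        proof -
          have "Suc k \<le> 2^k" by (rule Suc_leI[OF less_exp])
          then have "real (Suc k) \<le> real (2^k)" by (rule of_nat_mono)
          then show ?thesis by simp
        qed
        ultimately show ?thesis by (simp add: algebra_simps)
      qed
      then have "\<gamma> * r * (1 + 2^n + real k) \<le> \<gamma> * r * (1 + 2^(n+k))"
        using rate_pos r0 by (intro mult_left_mono) (auto simp: power_add)
      then have "- \<gamma> * r * (1 + 2^(n+k)) \<le> - \<gamma> * r * (1 + 2^n) + real k * (- \<gamma> * r)"
        by (simp add: algebra_simps)
      then show ?thesis by (intro mult_right_mono ball_mass_nonneg) simp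
    qed
    also have "\<dots> = ?C * ?q^k"
      by (simp only: exp_add exp_of_nat_mult mult.assoc mult.commute[of _ "ball_mass r"])
    finally show "?a k * ball_mass (2^(n+k+1) * r) \<le> ?C * ?q^k" .
  qed auto
  also have "\<dots> = ennreal (\<Sum>k. ?C * ?q^k)"
    using q one by (intro suminf_ennreal2 summable_mult summable_geometric)
      (auto intro!: mult_nonneg_nonneg ball_mass_nonneg)
  also have "(\<Sum>k. ?C * ?q^k) = ?C * (1 / (1 - ?q))"
    using q one by (subst suminf_mult) (auto simp: suminf_geometric intro!: summable_geometric)
  also have "\<dots> \<le> ?C * 2"
    using q one by (intro mult_left_mono mult_nonneg_nonneg ball_mass_nonneg) (auto simp: field_simps)
  finally show ?thesis by (simp add: ennreal_leI mult.commute mult.left_commute)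
qed

lemma exp_integral_le:
  assumes c: "3 * \<gamma> \<le> c" and one: "1 \<le> \<gamma> * r"
  shows "(\<integral>\<^sup>+\<theta>. ennreal (exp (- c * l \<theta>s \<theta>)) \<partial>\<pi>) \<le> ennreal (2 * ball_mass r)"
proof -
  let ?V = "loss_ball (space \<pi>) l \<theta>s r"
  have c0: "0 \<le> c" using c rate_pos by simp
  have "(\<integral>\<^sup>+\<theta>. ennreal (exp (- c * l \<theta>s \<theta>)) \<partial>\<pi>)
      \<le> (\<integral>\<^sup>+\<theta>. indicator ?V \<theta> + ennreal (exp (- c * l \<theta>s \<theta>)) * indicator (space \<pi> - ?V) \<theta> \<partial>\<pi>)"
  proof (intro nn_integral_mono)
    fix \<theta> assume \<theta>: "\<theta> \<in> space \<pi>"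
    have "ennreal (exp (- c * l \<theta>s \<theta>)) \<le> 1" using loss_nonneg[OF \<theta>] c0 by simp
    then show "ennreal (exp (- c * l \<theta>s \<theta>))
      \<le> indicator ?V \<theta> + ennreal (exp (- c * l \<theta>s \<theta>)) * indicator (space \<pi> - ?V) \<theta>"
      using \<theta> by (auto split: split_indicator)
  qed
  also have "\<dots> = ennreal (ball_mass r)
      + (\<integral>\<^sup>+\<theta>\<in>space \<pi> - ?V. ennreal (exp (- c * l \<theta>s \<theta>)) \<partial>\<pi>)"
    by (subst nn_integral_add) (auto simp: emeasure_ball)
  also have "\<dots> \<le> ennreal (ball_mass r) + ennreal (2 * exp (- \<gamma> * r * 2) * ball_mass r)"
    using tail_exp_integral_le[OF c one, of 0] by (intro add_mono) auto
  also have "\<dots> \<le> ennreal (2 * ball_mass r)"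
  proof -
    have "2 \<le> exp (\<gamma> * r * 2)" using exp_ge_add_one_self[of "\<gamma> * r * 2"] one by linarith
    then have "2 * exp (- \<gamma> * r * 2) \<le> 1" by (simp add: exp_minus field_simps)
    then have "2 * exp (- \<gamma> * r * 2) * ball_mass r \<le> 1 * ball_mass r"
      by (intro mult_right_mono ball_mass_nonneg)
    then show ?thesis
      by (simp add: ennreal_plus[symmetric] ball_mass_nonneg ennreal_leI del: ennreal_plus)
  qed
  finally show ?thesis .
qed

end

end

section \<open>The posterior of a test statistic\<close>

text \<open>A test statistic with prior \<open>\<pi>\<close>, observed through \<open>X\<close> on a probability space \<open>N\<close>, whose
  posterior is well defined at every outcome.\<close>

locale bayes_test = prob_space \<pi> + sample: prob_space N
  for \<pi> :: "'t measure" and N :: "'w measure" +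
  fixes E :: "'e measure" and X :: "'w \<Rightarrow> 'e" and T :: "'e \<Rightarrow> 't \<Rightarrow> 't \<Rightarrow> real"
    and lam \<beta> :: real
  assumes X_measurable [measurable]: "X \<in> measurable N E"
    and T_measurable: "(\<lambda>(x, \<theta>, \<theta>'). T x \<theta> \<theta>') \<in> borel_measurable (E \<Otimes>\<^sub>M (\<pi> \<Otimes>\<^sub>M \<pi>))"
    and well_defined: "\<And>\<omega>. \<omega> \<in> space N \<Longrightarrow> posterior_well_defined \<pi> T lam \<beta> (X \<omega>)"
begin

lemma T_measurable_compose [measurable (raw)]:
  assumes [measurable]: "f \<in> measurable K E" "g \<in> measurable K \<pi>" "h \<in> measurable K \<pi>"
  shows "(\<lambda>z. T (f z) (g z) (h z)) \<in> borel_measurable K"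
  using measurable_compose[OF _ T_measurable, of "\<lambda>z. (f z, g z, h z)" K] by simp

lemma avg_test_measurable [measurable (raw)]:
  assumes [measurable]: "f \<in> measurable K E" "g \<in> measurable K \<pi>"
  shows "(\<lambda>z. avg_test \<pi> T lam (f z) (g z)) \<in> borel_measurable K"
  unfolding avg_test_def by measurable

lemma X_space: "\<omega> \<in> space N \<Longrightarrow> X \<omega> \<in> space E"
  using measurable_space[OF X_measurable] .

text \<open>The normalising constant of the prior tilted by \<open>exp (lam * T x \<theta> \<theta>')\<close>, under which \<^const>\<open>avg_test\<close>
  is the mean of \<open>T x \<theta>\<close>.\<close>

definition test_normaliser :: "'e \<Rightarrow> 't \<Rightarrow> real" where
  "test_normaliser x \<theta> = (\<integral>\<theta>'. exp (lam * T x \<theta> \<theta>') \<partial>\<pi>)"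

text \<open>The denominator of the posterior density.\<close>

definition posterior_normaliser :: "'e \<Rightarrow> real" where
  "posterior_normaliser x = (\<integral>\<theta>. exp (- lam * (1 - \<beta>) * avg_test \<pi> T lam x \<theta>) \<partial>\<pi>)"

lemma posterior_normaliser_measurable [measurable (raw)]:
  assumes [measurable]: "f \<in> measurable K E"
  shows "(\<lambda>z. posterior_normaliser (f z)) \<in> borel_measurable K"
  unfolding posterior_normaliser_def by measurable

context
  fixes \<omega> :: 'w
  assumes \<omega>: "\<omega> \<in> space N"
begin

lemma posterior_exp_integrable:
  "integrable \<pi> (\<lambda>\<theta>. exp (- lam * (1 - \<beta>) * avg_test \<pi> T lam (X \<omega>) \<theta>))"
  using well_defined[OF \<omega>] by (simp add: posterior_well_defined_def)

lemma test_normaliser_pos: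
  assumes "\<theta> \<in> space \<pi>"
  shows "0 < test_normaliser (X \<omega>) \<theta>"
  unfolding test_normaliser_def
  using well_defined[OF \<omega>] assms by (intro expectation_greater) (auto simp: posterior_well_defined_def)

lemma posterior_normaliser_pos: "0 < posterior_normaliser (X \<omega>)"
  unfolding posterior_normaliser_def
  using posterior_exp_integrable by (intro expectation_greater) auto

text \<open>Convexity of the cumulant generating function of the test statistic under the prior: its
  derivative at \<open>lam\<close> is the averaged statistic, so its increment from \<open>lam\<close> to \<open>lam * (s + 1)\<close>
  is at least \<open>lam * s\<close> times that. The proof is Jensen's inequality for the tilted prior, and needs
  no finiteness of the right-hand side.\<close>

lemma exp_avg_test_le:
  assumes \<theta>: "\<theta> \<in> space \<pi>"
  shows "ennreal (exp (lam * s * avg_test \<pi> T lam (X \<omega>) \<theta>))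
    \<le> ennreal (1 / test_normaliser (X \<omega>) \<theta>) * (\<integral>\<^sup>+\<theta>'. ennreal (exp (lam * (s + 1) * T (X \<omega>) \<theta> \<theta>')) \<partial>\<pi>)"
proof -
  let ?Z = "test_normaliser (X \<omega>) \<theta>"
  let ?d = "\<lambda>\<theta>'. exp (lam * T (X \<omega>) \<theta> \<theta>') / ?Z"
  let ?f = "\<lambda>\<theta>'. lam * s * T (X \<omega>) \<theta> \<theta>'"
  let ?P = "density \<pi> (\<lambda>\<theta>'. ennreal (?d \<theta>'))"
  note [measurable] = X_space[OF \<omega>] \<theta>
  have Z: "0 < ?Z" by (rule test_normaliser_pos[OF \<theta>])
  have int1: "integrable \<pi> (\<lambda>\<theta>'. exp (lam * T (X \<omega>) \<theta> \<theta>'))"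
    and int2: "integrable \<pi> (\<lambda>\<theta>'. T (X \<omega>) \<theta> \<theta>' * ?d \<theta>')"
    using well_defined[OF \<omega>] \<theta> by (auto simp: posterior_well_defined_def test_normaliser_def)
  have "(\<integral>\<^sup>+\<theta>'. ennreal (?d \<theta>') \<partial>\<pi>) = ennreal (\<integral>\<theta>'. ?d \<theta>' \<partial>\<pi>)"
    using int1 Z by (intro nn_integral_eq_integral) auto
  also have "(\<integral>\<theta>'. ?d \<theta>' \<partial>\<pi>) = 1" using Z by (simp add: test_normaliser_def)
  finally have "emeasure ?P (space ?P) = 1"
    by (simp add: emeasure_density cong: nn_integral_cong)
  then interpret P: prob_space ?P by (rule prob_spaceI)
  have "integrable \<pi> (\<lambda>\<theta>'. lam * s * (T (X \<omega>) \<theta> \<theta>' * ?d \<theta>'))"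
    by (intro integrable_mult_right int2)
  then have "integrable \<pi> (\<lambda>\<theta>'. ?d \<theta>' *\<^sub>R ?f \<theta>')"
    by (simp add: mult_ac)
  then have "integrable ?P ?f"
    using Z by (subst integrable_density) auto
  from P.exp_expectation_le_nn_integral[OF this]
  have "ennreal (exp (\<integral>\<theta>'. ?f \<theta>' \<partial>?P)) \<le> (\<integral>\<^sup>+\<theta>'. ennreal (exp (?f \<theta>')) \<partial>?P)" .
  also have "(\<integral>\<theta>'. ?f \<theta>' \<partial>?P) = (\<integral>\<theta>'. lam * s * (T (X \<omega>) \<theta> \<theta>' * ?d \<theta>') \<partial>\<pi>)"
    using Z by (subst integral_density) (auto simp: mult_ac)
  also have "\<dots> = lam * s * avg_test \<pi> T lam (X \<omega>) \<theta>"
    by (simp only: avg_test_def test_normaliser_def integral_mult_right_zero)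
  also have "(\<integral>\<^sup>+\<theta>'. ennreal (exp (?f \<theta>')) \<partial>?P)
      = (\<integral>\<^sup>+\<theta>'. ennreal (?d \<theta>') * ennreal (exp (?f \<theta>')) \<partial>\<pi>)"
    by (subst nn_integral_density) auto
  also have "\<dots> = (\<integral>\<^sup>+\<theta>'. ennreal (1 / ?Z) * ennreal (exp (lam * (s + 1) * T (X \<omega>) \<theta> \<theta>')) \<partial>\<pi>)"
  proof (intro nn_integral_cong)
    fix \<theta>'
    have "?d \<theta>' * exp (?f \<theta>') = 1 / ?Z * exp (lam * (s + 1) * T (X \<omega>) \<theta> \<theta>')"
      by (simp add: algebra_simps flip: exp_add)
    then show "ennreal (?d \<theta>') * ennreal (exp (?f \<theta>'))
      = ennreal (1 / ?Z) * ennreal (exp (lam * (s + 1) * T (X \<omega>) \<theta> \<theta>'))"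
      using Z by (metis ennreal_mult' ennreal_mult'' exp_ge_zero)
  qed
  also have "\<dots> = ennreal (1 / ?Z) * (\<integral>\<^sup>+\<theta>'. ennreal (exp (lam * (s + 1) * T (X \<omega>) \<theta> \<theta>')) \<partial>\<pi>)"
    by (rule nn_integral_cmult) measurable
  finally show ?thesis .
qed

text \<open>Bounding also the inverse of the normaliser, by its convexity on a set \<open>V\<close> of positive prior
  mass, brings in the third parameter of \<^const>\<open>Delta\<close>.\<close>

lemma exp_avg_test_le_Delta:
  assumes \<theta>: "\<theta> \<in> space \<pi>" and [measurable]: "V \<in> sets \<pi>" and V: "0 < prob V"
  shows "ennreal (exp (lam * (\<kappa> - 1) * avg_test \<pi> T lam (X \<omega>) \<theta>))
    \<le> ennreal (1 / (prob V)\<^sup>2) *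
        (\<integral>\<^sup>+\<theta>2. (\<integral>\<^sup>+\<theta>1\<in>V. ennreal (exp (lam * Delta T \<kappa> (X \<omega>) \<theta>1 \<theta>2 \<theta>)) \<partial>\<pi>) \<partial>\<pi>)"
proof -
  let ?Z = "test_normaliser (X \<omega>) \<theta>"
  let ?I = "\<integral>\<^sup>+\<theta>1\<in>V. ennreal (1 / exp (lam * T (X \<omega>) \<theta> \<theta>1)) \<partial>\<pi>"
  let ?h = "\<lambda>\<theta>2. ennreal (exp (lam * \<kappa> * T (X \<omega>) \<theta> \<theta>2))"
  note [measurable] = X_space[OF \<omega>] \<theta>
  have Z: "0 < ?Z" by (rule test_normaliser_pos[OF \<theta>])
  have int1: "integrable \<pi> (\<lambda>\<theta>'. exp (lam * T (X \<omega>) \<theta> \<theta>'))"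
    using well_defined[OF \<omega>] \<theta> by (auto simp: posterior_well_defined_def)
  have "(\<integral>\<^sup>+\<theta>1\<in>V. ennreal (exp (lam * T (X \<omega>) \<theta> \<theta>1)) \<partial>\<pi>)
      \<le> (\<integral>\<^sup>+\<theta>1. ennreal (exp (lam * T (X \<omega>) \<theta> \<theta>1)) \<partial>\<pi>)"
    by (intro nn_integral_mono) (auto split: split_indicator)
  also have "\<dots> = ennreal ?Z"
    unfolding test_normaliser_def using int1 by (intro nn_integral_eq_integral) auto
  finally have "ennreal (1 / ?Z) \<le> ennreal (1 / (prob V)\<^sup>2) * ?I"
    using V Z by (intro inverse_le_nn_integral_inverse) auto
  moreover have "ennreal (exp (lam * (\<kappa> - 1) * avg_test \<pi> T lam (X \<omega>) \<theta>))
      \<le> ennreal (1 / ?Z) * (\<integral>\<^sup>+\<theta>2. ?h \<theta>2 \<partial>\<pi>)"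
    using exp_avg_test_le[OF \<theta>, of "\<kappa> - 1"] by simp
  ultimately have "ennreal (exp (lam * (\<kappa> - 1) * avg_test \<pi> T lam (X \<omega>) \<theta>))
      \<le> ennreal (1 / (prob V)\<^sup>2) * ?I * (\<integral>\<^sup>+\<theta>2. ?h \<theta>2 \<partial>\<pi>)"
    by (meson mult_right_mono order_trans zero_le)
  also have "?I * (\<integral>\<^sup>+\<theta>2. ?h \<theta>2 \<partial>\<pi>) = (\<integral>\<^sup>+\<theta>2. ?I * ?h \<theta>2 \<partial>\<pi>)"
    by (intro nn_integral_cmult[symmetric]) measurable
  then have "ennreal (1 / (prob V)\<^sup>2) * ?I * (\<integral>\<^sup>+\<theta>2. ?h \<theta>2 \<partial>\<pi>)
    = ennreal (1 / (prob V)\<^sup>2) * (\<integral>\<^sup>+\<theta>2. ?I * ?h \<theta>2 \<partial>\<pi>)"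
    by (simp add: mult.assoc)
  also have "(\<integral>\<^sup>+\<theta>2. ?I * ?h \<theta>2 \<partial>\<pi>)
    = (\<integral>\<^sup>+\<theta>2. (\<integral>\<^sup>+\<theta>1\<in>V. ennreal (exp (lam * Delta T \<kappa> (X \<omega>) \<theta>1 \<theta>2 \<theta>)) \<partial>\<pi>) \<partial>\<pi>)"
  proof (intro nn_integral_cong)
    fix \<theta>2 assume [measurable]: "\<theta>2 \<in> space \<pi>"
    have "?I * ?h \<theta>2 =
      (\<integral>\<^sup>+\<theta>1. ennreal (1 / exp (lam * T (X \<omega>) \<theta> \<theta>1)) * indicator V \<theta>1 * ?h \<theta>2 \<partial>\<pi>)"
      by (intro nn_integral_multc[symmetric]) measurable
    also have "\<dots> = (\<integral>\<^sup>+\<theta>1\<in>V. ennreal (exp (lam * Delta T \<kappa> (X \<omega>) \<theta>1 \<theta>2 \<theta>)) \<partial>\<pi>)"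
      by (intro nn_integral_cong)
         (auto simp: Delta_def algebra_simps exp_diff ennreal_mult'[symmetric] split: split_indicator)
    finally show "?I * ?h \<theta>2
      = (\<integral>\<^sup>+\<theta>1\<in>V. ennreal (exp (lam * Delta T \<kappa> (X \<omega>) \<theta>1 \<theta>2 \<theta>)) \<partial>\<pi>)" .
  qed
  finally show ?thesis .
qed

lemma emeasure_posterior:
  assumes [measurable]: "C \<in> sets \<pi>"
  shows "emeasure (posterior \<pi> T lam \<beta> (X \<omega>)) C = ennreal (1 / posterior_normaliser (X \<omega>)) *
    (\<integral>\<^sup>+\<theta>\<in>C. ennreal (exp (lam * (\<beta> - 1) * avg_test \<pi> T lam (X \<omega>) \<theta>)) \<partial>\<pi>)"
proof -
  let ?D = "posterior_normaliser (X \<omega>)"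
  let ?e = "\<lambda>\<theta>. exp (lam * (\<beta> - 1) * avg_test \<pi> T lam (X \<omega>) \<theta>)"
  note [measurable] = X_space[OF \<omega>]
  have e: "- lam * (1 - \<beta>) = lam * (\<beta> - 1)" by (simp add: algebra_simps)
  have "emeasure (posterior \<pi> T lam \<beta> (X \<omega>)) C = (\<integral>\<^sup>+\<theta>\<in>C. ennreal (?e \<theta> / ?D) \<partial>\<pi>)"
    unfolding posterior_def e posterior_normaliser_def[unfolded e, symmetric]
    by (rule emeasure_density) measurable
  also have "\<dots> = (\<integral>\<^sup>+\<theta>. ennreal (1 / ?D) * (ennreal (?e \<theta>) * indicator C \<theta>) \<partial>\<pi>)"
    using posterior_normaliser_pos
    by (intro nn_integral_cong) (simp add: ennreal_mult'[symmetric] mult.assoc[symmetric])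
  also have "\<dots> = ennreal (1 / ?D) * (\<integral>\<^sup>+\<theta>\<in>C. ennreal (?e \<theta>) \<partial>\<pi>)"
    by (rule nn_integral_cmult) measurable
  finally show ?thesis .
qed

lemma posterior_exp_nn_integral:
  "(\<integral>\<^sup>+\<theta>. ennreal (exp (lam * (\<beta> - 1) * avg_test \<pi> T lam (X \<omega>) \<theta>)) \<partial>\<pi>)
    = ennreal (posterior_normaliser (X \<omega>))"
proof -
  have e: "- lam * (1 - \<beta>) = lam * (\<beta> - 1)" by (simp add: algebra_simps)
  show ?thesis unfolding posterior_normaliser_def e
    using posterior_exp_integrable[unfolded e] by (intro nn_integral_eq_integral) auto
qed

lemma prob_space_posterior: "prob_space (posterior \<pi> T lam \<beta> (X \<omega>))"
proof (rule prob_spaceI)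
  have "emeasure (posterior \<pi> T lam \<beta> (X \<omega>)) (space \<pi>) = 1"
    using posterior_normaliser_pos
    by (simp add: emeasure_posterior posterior_exp_nn_integral ennreal_mult'[symmetric]
        cong: nn_integral_cong)
  then show "emeasure (posterior \<pi> T lam \<beta> (X \<omega>)) (space (posterior \<pi> T lam \<beta> (X \<omega>))) = 1"
    by (simp add: posterior_def)
qed

text \<open>A posterior mass is at most one, hence at most the geometric mean of its unnormalised mass
  and of the inverse of the normaliser; by the arithmetic mean this bound is linear in both.\<close>

lemma emeasure_posterior_le:
  assumes [measurable]: "C \<in> sets \<pi>" and t: "0 < t"
  shows "emeasure (posterior \<pi> T lam \<beta> (X \<omega>)) C
    \<le> ennreal (t / 2) * (\<integral>\<^sup>+\<theta>\<in>C. ennreal (exp (lam * (\<beta> - 1) * avg_test \<pi> T lam (X \<omega>) \<theta>)) \<partial>\<pi>)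
      + ennreal (1 / (2 * t)) * ennreal (1 / posterior_normaliser (X \<omega>))"
    (is "_ \<le> _ * ?num + _")
proof -
  let ?D = "posterior_normaliser (X \<omega>)"
  have D: "0 < ?D" by (rule posterior_normaliser_pos)
  have le: "?num \<le> ennreal ?D"
    unfolding posterior_exp_nn_integral[symmetric]
    by (intro nn_integral_mono) (auto split: split_indicator)
  define v where "v = enn2real ?num"
  have v: "?num = ennreal v" "0 \<le> v" using le
    by (auto simp: v_def top_unique less_top[symmetric] neq_top_trans[OF ennreal_neq_top])
  have "v \<le> ?D" using le D unfolding v by simp
  define a where "a = t * v"
  define b where "b = 1 / ?D / t"
  have ab: "0 \<le> a" "0 \<le> b" "a * b = v / ?D" using t v D by (auto simp: a_def b_def)
  have "a * b \<le> 1" using \<open>v \<le> ?D\<close> D ab(3) by simp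
  then have "(a * b)\<^sup>2 \<le> a * b" using ab(1,2) by (simp add: power2_eq_square mult_left_le)
  then have "a * b \<le> sqrt (a * b)" by (rule real_le_rsqrt)
  also have "\<dots> \<le> (a + b) / 2" by (rule arith_geo_mean_sqrt[OF ab(1,2)])
  finally have "v / ?D \<le> t / 2 * v + 1 / (2 * t) * (1 / ?D)"
    unfolding ab(3) using t by (simp add: a_def b_def field_simps)
  then have "ennreal (v / ?D) \<le> ennreal (t / 2) * ennreal v + ennreal (1 / (2 * t)) * ennreal (1 / ?D)"
    using t v D by (simp add: ennreal_mult'[symmetric] ennreal_plus[symmetric] ennreal_leI
        del: ennreal_plus)
  moreover have "emeasure (posterior \<pi> T lam \<beta> (X \<omega>)) C = ennreal (v / ?D)"
    using D v(2) by (simp add: emeasure_posterior v(1) ennreal_mult'[symmetric])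
  ultimately show ?thesis by (simp add: v(1))
qed

end

lemma emeasure_posterior_measurable [measurable]:
  assumes [measurable]: "C \<in> sets \<pi>"
  shows "(\<lambda>\<omega>. emeasure (posterior \<pi> T lam \<beta> (X \<omega>)) C) \<in> borel_measurable N"
  using emeasure_posterior[OF _ assms] by (subst measurable_cong) auto

text \<open>The fourfold integral bounding the expectation is taken in an order that puts the Laplace
  transform innermost.\<close>

lemma expected_exp_avg_test_le:
  assumes [measurable]: "V \<in> sets \<pi>" "W \<in> sets \<pi>" and V: "0 < prob V"
  shows "(\<integral>\<^sup>+\<omega>. (\<integral>\<^sup>+\<theta>3\<in>W. ennreal (exp (lam * (\<kappa> - 1) * avg_test \<pi> T lam (X \<omega>) \<theta>3)) \<partial>\<pi>) \<partial>N)
    \<le> ennreal (1 / (prob V)\<^sup>2) * (\<integral>\<^sup>+\<theta>3\<in>W. (\<integral>\<^sup>+\<theta>2. (\<integral>\<^sup>+\<theta>1\<in>V.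
        (\<integral>\<^sup>+\<omega>. ennreal (exp (lam * Delta T \<kappa> (X \<omega>) \<theta>1 \<theta>2 \<theta>3)) \<partial>N) \<partial>\<pi>) \<partial>\<pi>) \<partial>\<pi>)"
proof -
  interpret NP: pair_sigma_finite N \<pi> ..
  let ?g = "\<lambda>\<omega> \<theta>1 \<theta>2 \<theta>3. ennreal (exp (lam * Delta T \<kappa> (X \<omega>) \<theta>1 \<theta>2 \<theta>3))"
  let ?p = "ennreal (1 / (prob V)\<^sup>2)"
  have [measurable (raw)]: "(\<lambda>z. Delta T \<kappa> (f z) (a z) (b z) (c z)) \<in> borel_measurable K"
    if [measurable]: "f \<in> measurable K E" "a \<in> measurable K \<pi>" "b \<in> measurable K \<pi>" "c \<in> measurable K \<pi>"
    for f a b c and K :: "'k measure"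
    unfolding Delta_def by measurable
  have "(\<integral>\<^sup>+\<omega>. (\<integral>\<^sup>+\<theta>3\<in>W. ennreal (exp (lam * (\<kappa> - 1) * avg_test \<pi> T lam (X \<omega>) \<theta>3)) \<partial>\<pi>) \<partial>N)
    \<le> (\<integral>\<^sup>+\<omega>. (\<integral>\<^sup>+\<theta>3. ?p * (indicator W \<theta>3 *
          (\<integral>\<^sup>+\<theta>2. (\<integral>\<^sup>+\<theta>1\<in>V. ?g \<omega> \<theta>1 \<theta>2 \<theta>3 \<partial>\<pi>) \<partial>\<pi>)) \<partial>\<pi>) \<partial>N)"
    using exp_avg_test_le_Delta[OF _ _ assms(1) V, of _ _ \<kappa>]
    by (intro nn_integral_mono) (auto split: split_indicator)
  also have "\<dots> = (\<integral>\<^sup>+\<omega>. ?p * (\<integral>\<^sup>+\<theta>3. indicator W \<theta>3 *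
          (\<integral>\<^sup>+\<theta>2. (\<integral>\<^sup>+\<theta>1\<in>V. ?g \<omega> \<theta>1 \<theta>2 \<theta>3 \<partial>\<pi>) \<partial>\<pi>) \<partial>\<pi>) \<partial>N)"
    by (intro nn_integral_cong nn_integral_cmult) measurable
  also have "\<dots> = ?p * (\<integral>\<^sup>+\<omega>. (\<integral>\<^sup>+\<theta>3. indicator W \<theta>3 *
          (\<integral>\<^sup>+\<theta>2. (\<integral>\<^sup>+\<theta>1\<in>V. ?g \<omega> \<theta>1 \<theta>2 \<theta>3 \<partial>\<pi>) \<partial>\<pi>) \<partial>\<pi>) \<partial>N)"
    by (rule nn_integral_cmult) measurable
  also have "(\<integral>\<^sup>+\<omega>. (\<integral>\<^sup>+\<theta>3. indicator W \<theta>3 *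
          (\<integral>\<^sup>+\<theta>2. (\<integral>\<^sup>+\<theta>1\<in>V. ?g \<omega> \<theta>1 \<theta>2 \<theta>3 \<partial>\<pi>) \<partial>\<pi>) \<partial>\<pi>) \<partial>N)
    = (\<integral>\<^sup>+\<theta>3. (\<integral>\<^sup>+\<omega>. indicator W \<theta>3 *
          (\<integral>\<^sup>+\<theta>2. (\<integral>\<^sup>+\<theta>1\<in>V. ?g \<omega> \<theta>1 \<theta>2 \<theta>3 \<partial>\<pi>) \<partial>\<pi>) \<partial>N) \<partial>\<pi>)"
    by (rule NP.Fubini'[symmetric]) measurable
  also have "\<dots> = (\<integral>\<^sup>+\<theta>3. indicator W \<theta>3 *
          (\<integral>\<^sup>+\<omega>. (\<integral>\<^sup>+\<theta>2. (\<integral>\<^sup>+\<theta>1\<in>V. ?g \<omega> \<theta>1 \<theta>2 \<theta>3 \<partial>\<pi>) \<partial>\<pi>) \<partial>N) \<partial>\<pi>)"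
    by (intro nn_integral_cong nn_integral_cmult) measurable
  also have "\<dots> = (\<integral>\<^sup>+\<theta>3. indicator W \<theta>3 *
          (\<integral>\<^sup>+\<theta>2. (\<integral>\<^sup>+\<omega>. (\<integral>\<^sup>+\<theta>1\<in>V. ?g \<omega> \<theta>1 \<theta>2 \<theta>3 \<partial>\<pi>) \<partial>N) \<partial>\<pi>) \<partial>\<pi>)"
    by (intro nn_integral_cong arg_cong2[where f="(*)"] refl NP.Fubini'[symmetric]) measurable
  also have "\<dots> = (\<integral>\<^sup>+\<theta>3. indicator W \<theta>3 *
          (\<integral>\<^sup>+\<theta>2. (\<integral>\<^sup>+\<theta>1. (\<integral>\<^sup>+\<omega>. ?g \<omega> \<theta>1 \<theta>2 \<theta>3 * indicator V \<theta>1 \<partial>N) \<partial>\<pi>) \<partial>\<pi>) \<partial>\<pi>)"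
    by (intro nn_integral_cong arg_cong2[where f="(*)"] refl NP.Fubini'[symmetric]) measurable
  also have "\<dots> = (\<integral>\<^sup>+\<theta>3. indicator W \<theta>3 *
          (\<integral>\<^sup>+\<theta>2. (\<integral>\<^sup>+\<theta>1\<in>V. (\<integral>\<^sup>+\<omega>. ?g \<omega> \<theta>1 \<theta>2 \<theta>3 \<partial>N) \<partial>\<pi>) \<partial>\<pi>) \<partial>\<pi>)"
    by (intro nn_integral_cong arg_cong2[where f="(*)"] refl nn_integral_multc) measurable
  finally show ?thesis by (simp add: mult.commute)
qed

lemma expected_exp_avg_test_le_loss:
  fixes L :: "'t \<Rightarrow> real"
  assumes [measurable]: "V \<in> sets \<pi>" "W \<in> sets \<pi>" "L \<in> borel_measurable \<pi>" and V: "0 < prob V"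
    and L: "\<And>\<theta>. \<theta> \<in> V \<Longrightarrow> L \<theta> \<le> r" and c1: "0 \<le> c1"
    and laplace: "\<And>\<theta>1 \<theta>2 \<theta>3. \<theta>1 \<in> space \<pi> \<Longrightarrow> \<theta>2 \<in> space \<pi> \<Longrightarrow> \<theta>3 \<in> space \<pi> \<Longrightarrow>
      (\<integral>\<^sup>+\<omega>. ennreal (exp (lam * Delta T \<kappa> (X \<omega>) \<theta>1 \<theta>2 \<theta>3)) \<partial>N)
        \<le> ennreal (exp (A + (c1 * L \<theta>1 - c2 * L \<theta>2 + c3 * L \<theta>3)))"
  shows "(\<integral>\<^sup>+\<omega>. (\<integral>\<^sup>+\<theta>3\<in>W. ennreal (exp (lam * (\<kappa> - 1) * avg_test \<pi> T lam (X \<omega>) \<theta>3)) \<partial>\<pi>) \<partial>N)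
    \<le> ennreal (exp (A + c1 * r) / prob V) * (\<integral>\<^sup>+\<theta>2. ennreal (exp (- c2 * L \<theta>2)) \<partial>\<pi>)
        * (\<integral>\<^sup>+\<theta>3\<in>W. ennreal (exp (c3 * L \<theta>3)) \<partial>\<pi>)"
proof -
  let ?p = "prob V"
  let ?K = "ennreal (exp (A + c1 * r) * ?p)"
  let ?h2 = "\<lambda>\<theta>. ennreal (exp (- c2 * L \<theta>))" and ?h3 = "\<lambda>\<theta>. ennreal (exp (c3 * L \<theta>))"
  have inner: "(\<integral>\<^sup>+\<theta>1\<in>V. (\<integral>\<^sup>+\<omega>. ennreal (exp (lam * Delta T \<kappa> (X \<omega>) \<theta>1 \<theta>2 \<theta>3)) \<partial>N) \<partial>\<pi>)
      \<le> ?K * ?h2 \<theta>2 * ?h3 \<theta>3" if \<theta>: "\<theta>2 \<in> space \<pi>" "\<theta>3 \<in> space \<pi>" for \<theta>2 \<theta>3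
  proof -
    let ?c = "exp (A + c1 * r) * exp (- c2 * L \<theta>2) * exp (c3 * L \<theta>3)"
    have "(\<integral>\<^sup>+\<theta>1\<in>V. (\<integral>\<^sup>+\<omega>. ennreal (exp (lam * Delta T \<kappa> (X \<omega>) \<theta>1 \<theta>2 \<theta>3)) \<partial>N) \<partial>\<pi>)
      \<le> (\<integral>\<^sup>+\<theta>1\<in>V. ennreal ?c \<partial>\<pi>)"
    proof (intro nn_integral_mono)
      fix \<theta>1 assume "\<theta>1 \<in> space \<pi>"
      note laplace[OF this \<theta>]
      also have "ennreal (exp (A + (c1 * L \<theta>1 - c2 * L \<theta>2 + c3 * L \<theta>3))) \<le> ennreal ?c" if "\<theta>1 \<in> V"
        using mult_left_mono[OF L[OF that] c1]
        by (intro ennreal_leI) (simp flip: exp_add)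
      finally show "(\<integral>\<^sup>+\<omega>. ennreal (exp (lam * Delta T \<kappa> (X \<omega>) \<theta>1 \<theta>2 \<theta>3)) \<partial>N) * indicator V \<theta>1
          \<le> ennreal ?c * indicator V \<theta>1"
        by (auto split: split_indicator)
    qed
    also have "\<dots> = ?K * ?h2 \<theta>2 * ?h3 \<theta>3"
      by (subst nn_integral_cmult_indicator)
         (simp_all add: emeasure_eq_measure ennreal_mult'[symmetric] mult_ac)
    finally show ?thesis .
  qed
  have "(\<integral>\<^sup>+\<theta>3\<in>W. (\<integral>\<^sup>+\<theta>2. (\<integral>\<^sup>+\<theta>1\<in>V.
        (\<integral>\<^sup>+\<omega>. ennreal (exp (lam * Delta T \<kappa> (X \<omega>) \<theta>1 \<theta>2 \<theta>3)) \<partial>N) \<partial>\<pi>) \<partial>\<pi>) \<partial>\<pi>)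
     \<le> (\<integral>\<^sup>+\<theta>3\<in>W. (\<integral>\<^sup>+\<theta>2. ?K * ?h2 \<theta>2 * ?h3 \<theta>3 \<partial>\<pi>) \<partial>\<pi>)"
    by (intro nn_integral_mono mult_right_mono inner) auto
  also have "\<dots> = (\<integral>\<^sup>+\<theta>3. ?K * (\<integral>\<^sup>+\<theta>2. ?h2 \<theta>2 \<partial>\<pi>) * (?h3 \<theta>3 * indicator W \<theta>3) \<partial>\<pi>)"
    by (intro nn_integral_cong) (simp add: nn_integral_multc nn_integral_cmult mult.assoc)
  also have "\<dots> = ?K * (\<integral>\<^sup>+\<theta>2. ?h2 \<theta>2 \<partial>\<pi>) * (\<integral>\<^sup>+\<theta>3\<in>W. ?h3 \<theta>3 \<partial>\<pi>)"
    by (rule nn_integral_cmult) measurable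
  finally have "ennreal (1 / ?p\<^sup>2) * (\<integral>\<^sup>+\<theta>3\<in>W. (\<integral>\<^sup>+\<theta>2. (\<integral>\<^sup>+\<theta>1\<in>V.
        (\<integral>\<^sup>+\<omega>. ennreal (exp (lam * Delta T \<kappa> (X \<omega>) \<theta>1 \<theta>2 \<theta>3)) \<partial>N) \<partial>\<pi>) \<partial>\<pi>) \<partial>\<pi>)
      \<le> ennreal (1 / ?p\<^sup>2) * (?K * (\<integral>\<^sup>+\<theta>2. ?h2 \<theta>2 \<partial>\<pi>) * (\<integral>\<^sup>+\<theta>3\<in>W. ?h3 \<theta>3 \<partial>\<pi>))"
    by (rule mult_left_mono) simp
  also have "\<dots> = ennreal (1 / ?p\<^sup>2) * ?K * (\<integral>\<^sup>+\<theta>2. ?h2 \<theta>2 \<partial>\<pi>) * (\<integral>\<^sup>+\<theta>3\<in>W. ?h3 \<theta>3 \<partial>\<pi>)"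
    by (simp only: mult.assoc)
  also have "ennreal (1 / ?p\<^sup>2) * ?K = ennreal (exp (A + c1 * r) / ?p)"
    using V by (simp add: ennreal_mult'[symmetric] power2_eq_square)
  finally show ?thesis
    using expected_exp_avg_test_le[OF assms(1,2) V, of \<kappa>] by (rule order_trans[rotated])
qed

end

section \<open>Expected posterior mass far from the centre\<close>

text \<open>A test statistic together with the loss from a fixed point of the parameter set.\<close>

locale centred_bayes_test = bayes_test \<pi> N E X T lam \<beta> + centred_prior \<pi> l \<theta>s \<gamma>
  for \<pi> :: "'t measure" and N :: "'w measure" and E :: "'e measure" and X T lam \<beta> l \<theta>s \<gamma>
begin

text \<open>Unprimed constants belong to \<open>\<kappa> = \<beta>\<close>, which controls the unnormalised posterior mass of the
  complement, and primed ones to \<open>\<kappa> = 2 - \<beta>\<close>, which controls the inverse of the normaliser.\<close>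

lemma expected_posterior_tail_le:
  fixes A A' c1 c1' c2 c2' c3 c3' \<xi> r :: real and n :: nat
  assumes laplace: "\<And>\<theta>1 \<theta>2 \<theta>3. \<theta>1 \<in> space \<pi> \<Longrightarrow> \<theta>2 \<in> space \<pi> \<Longrightarrow> \<theta>3 \<in> space \<pi> \<Longrightarrow>
      (\<integral>\<^sup>+\<omega>. ennreal (exp (lam * Delta T \<beta> (X \<omega>) \<theta>1 \<theta>2 \<theta>3)) \<partial>N)
        \<le> ennreal (exp (A + (c1 * l \<theta>s \<theta>1 - c2 * l \<theta>s \<theta>2 + c3 * l \<theta>s \<theta>3)))"
    and laplace': "\<And>\<theta>1 \<theta>2 \<theta>3. \<theta>1 \<in> space \<pi> \<Longrightarrow> \<theta>2 \<in> space \<pi> \<Longrightarrow> \<theta>3 \<in> space \<pi> \<Longrightarrow>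
      (\<integral>\<^sup>+\<omega>. ennreal (exp (lam * Delta T (2 - \<beta>) (X \<omega>) \<theta>1 \<theta>2 \<theta>3)) \<partial>N)
        \<le> ennreal (exp (A' + (c1' * l \<theta>s \<theta>1 - c2' * l \<theta>s \<theta>2 + c3' * l \<theta>s \<theta>3)))"
    and A: "0 \<le> A" "0 \<le> A'" and c1: "0 \<le> c1" "0 \<le> c1'" and c3': "0 \<le> c3'"
    and rates: "3 * \<gamma> \<le> c2" "3 * \<gamma> \<le> c2'" "3 * \<gamma> \<le> - c3"
    and \<xi>: "0 < \<xi>"
    and r: "r = complexity \<pi> l \<gamma> \<theta>s + ((A + A') / 2 + 1 + \<xi>) / \<gamma>"
    and n: "4 + 2 * (c1 + c1' + c3') / \<gamma> \<le> 2^n"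
  shows "(\<integral>\<^sup>+\<omega>. emeasure (posterior \<pi> T lam \<beta> (X \<omega>))
            (space \<pi> - loss_ball (space \<pi>) l \<theta>s (2^n * r)) \<partial>N) \<le> ennreal (2 * exp (- \<xi>))"
proof -
  let ?V = "loss_ball (space \<pi>) l \<theta>s r"
  let ?C = "space \<pi> - loss_ball (space \<pi>) l \<theta>s (2^n * r)"
  let ?D = "\<lambda>\<omega>. posterior_normaliser (X \<omega>)"
  let ?num = "\<lambda>\<omega>. \<integral>\<^sup>+\<theta>\<in>?C. ennreal (exp (lam * (\<beta> - 1) * avg_test \<pi> T lam (X \<omega>) \<theta>)) \<partial>\<pi>"
  let ?inv = "\<lambda>\<omega>. \<integral>\<^sup>+\<theta>\<in>?V. ennreal (exp (lam * ((2 - \<beta>) - 1) * avg_test \<pi> T lam (X \<omega>) \<theta>)) \<partial>\<pi>"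
  define p where "p = prob ?V"
  define S where "S = c1 + c1' + c3'"
  have \<gamma>: "0 < \<gamma>" by (rule rate_pos)
  have compl: "complexity \<pi> l \<gamma> \<theta>s \<le> r" using r A \<xi> \<gamma> by simp
  have "\<gamma> * r = \<gamma> * complexity \<pi> l \<gamma> \<theta>s + ((A + A') / 2 + 1 + \<xi>)"
    unfolding r distrib_left using \<gamma> by simp
  then have \<gamma>r: "(A + A') / 2 + 1 + \<xi> \<le> \<gamma> * r"
    using complexity_nonneg \<gamma> by simp
  moreover have "1 \<le> (A + A') / 2 + 1 + \<xi>" using A \<xi> by simp
  ultimately have one: "1 \<le> \<gamma> * r" by (rule order_trans[rotated])
  have r0: "0 \<le> r" using compl complexity_nonneg by simp
  have p: "0 < p" using ball_mass_pos[OF compl] by (simp add: p_def ball_mass_def)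
  have pm: "ball_mass r = p" by (simp add: p_def ball_mass_def)
  have V: "0 < prob ?V" using p by (simp add: p_def)
  have Vl: "\<And>\<theta>. \<theta> \<in> ?V \<Longrightarrow> l \<theta>s \<theta> \<le> r" by (simp add: loss_ball_def)

  have mult3: "ennreal a * ennreal b * ennreal c = ennreal (a * b * c)"
    if "0 \<le> a" "0 \<le> b" for a b c
    using that by (simp add: ennreal_mult')
  have mult4: "ennreal d * (ennreal a * ennreal b * ennreal c) = ennreal (d * (a * b * c))"
    if "0 \<le> d" "0 \<le> a" "0 \<le> b" for a b c d
    using that by (simp add: ennreal_mult')

  have num: "(\<integral>\<^sup>+\<omega>. ?num \<omega> \<partial>N)
      \<le> ennreal (4 * p * exp (A + c1 * r - \<gamma> * r * (1 + 2^n)))"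
  proof -
    have "(\<integral>\<^sup>+\<omega>. ?num \<omega> \<partial>N) \<le> ennreal (exp (A + c1 * r) / p) *
        (\<integral>\<^sup>+\<theta>. ennreal (exp (- c2 * l \<theta>s \<theta>)) \<partial>\<pi>) * (\<integral>\<^sup>+\<theta>\<in>?C. ennreal (exp (c3 * l \<theta>s \<theta>)) \<partial>\<pi>)"
      using expected_exp_avg_test_le_loss[OF _ _ _ V Vl c1(1) laplace, of ?C]
      by (simp add: p_def)
    also have "\<dots> \<le> ennreal (exp (A + c1 * r) / p) * ennreal (2 * p) *
        ennreal (2 * exp (- \<gamma> * r * (1 + 2^n)) * p)"
      using exp_integral_le[OF compl rates(1) one] tail_exp_integral_le[OF compl rates(3) one, of n]
      by (intro mult_mono mult_left_mono) (auto simp: pm)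
    also have "\<dots> = ennreal (exp (A + c1 * r) / p * (2 * p) * (2 * exp (- \<gamma> * r * (1 + 2^n)) * p))"
      using p by (intro mult3) auto
    also have "exp (A + c1 * r) / p * (2 * p) * (2 * exp (- \<gamma> * r * (1 + 2^n)) * p)
        = 4 * p * (exp (A + c1 * r) * exp (- \<gamma> * r * (1 + 2^n)))"
      using p by simp
    also have "exp (A + c1 * r) * exp (- \<gamma> * r * (1 + 2^n)) = exp (A + c1 * r - \<gamma> * r * (1 + 2^n))"
      by (simp flip: exp_add)
    finally show ?thesis .
  qed

  have inv: "(\<integral>\<^sup>+\<omega>. ennreal (1 / ?D \<omega>) \<partial>N) \<le> ennreal (2 / p * exp (A' + (c1' + c3') * r))"
  proof -
    have "(\<integral>\<^sup>+\<omega>. ennreal (1 / ?D \<omega>) \<partial>N) \<le> (\<integral>\<^sup>+\<omega>. ennreal (1 / p\<^sup>2) * ?inv \<omega> \<partial>N)"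
    proof (intro nn_integral_mono)
      fix \<omega> assume \<omega>: "\<omega> \<in> space N"
      let ?f = "\<lambda>\<theta>. exp (lam * (\<beta> - 1) * avg_test \<pi> T lam (X \<omega>) \<theta>)"
      note [measurable] = X_space[OF \<omega>]
      have "(\<integral>\<^sup>+\<theta>\<in>?V. ennreal (?f \<theta>) \<partial>\<pi>) \<le> (\<integral>\<^sup>+\<theta>. ennreal (?f \<theta>) \<partial>\<pi>)"
        by (intro nn_integral_mono) (auto split: split_indicator)
      also have "\<dots> = ennreal (?D \<omega>)" by (rule posterior_exp_nn_integral[OF \<omega>])
      finally have "ennreal (1 / ?D \<omega>) \<le> ennreal (1 / p\<^sup>2) * (\<integral>\<^sup>+\<theta>\<in>?V. ennreal (1 / ?f \<theta>) \<partial>\<pi>)"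
        unfolding p_def using posterior_normaliser_pos[OF \<omega>] V
        by (intro inverse_le_nn_integral_inverse) auto
      also have "(\<lambda>\<theta>. 1 / ?f \<theta>) = (\<lambda>\<theta>. exp (lam * ((2 - \<beta>) - 1) * avg_test \<pi> T lam (X \<omega>) \<theta>))"
        by (simp add: fun_eq_iff inverse_eq_divide[symmetric] algebra_simps flip: exp_minus)
      finally show "ennreal (1 / ?D \<omega>) \<le> ennreal (1 / p\<^sup>2) * ?inv \<omega>" by (simp add: fun_eq_iff)
    qed
    also have "\<dots> = ennreal (1 / p\<^sup>2) * (\<integral>\<^sup>+\<omega>. ?inv \<omega> \<partial>N)"
      by (rule nn_integral_cmult) measurable
    also have "(\<integral>\<^sup>+\<omega>. ?inv \<omega> \<partial>N) \<le> ennreal (exp (A' + c1' * r) / p) *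
        (\<integral>\<^sup>+\<theta>. ennreal (exp (- c2' * l \<theta>s \<theta>)) \<partial>\<pi>) * (\<integral>\<^sup>+\<theta>\<in>?V. ennreal (exp (c3' * l \<theta>s \<theta>)) \<partial>\<pi>)"
      unfolding p_def
      by (rule expected_exp_avg_test_le_loss[OF _ _ _ V Vl c1(2) laplace']) auto
    also have "(\<integral>\<^sup>+\<theta>\<in>?V. ennreal (exp (c3' * l \<theta>s \<theta>)) \<partial>\<pi>) \<le> (\<integral>\<^sup>+\<theta>\<in>?V. ennreal (exp (c3' * r)) \<partial>\<pi>)"
      using c3' Vl
      by (intro nn_integral_mono) (auto intro!: ennreal_leI mult_left_mono split: split_indicator)
    also have "\<dots> = ennreal (exp (c3' * r) * p)"
      by (subst nn_integral_cmult_indicator)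
         (simp_all add: emeasure_ball pm ennreal_mult' p_def)
    also have "(\<integral>\<^sup>+\<theta>. ennreal (exp (- c2' * l \<theta>s \<theta>)) \<partial>\<pi>) \<le> ennreal (2 * p)"
      using exp_integral_le[OF compl rates(2) one] by (simp add: pm)
    finally have "(\<integral>\<^sup>+\<omega>. ennreal (1 / ?D \<omega>) \<partial>N) \<le> ennreal (1 / p\<^sup>2) *
        (ennreal (exp (A' + c1' * r) / p) * ennreal (2 * p) * ennreal (exp (c3' * r) * p))"
      by (simp add: mult_left_mono mult_right_mono)
    also have "\<dots> = ennreal (1 / p\<^sup>2 * (exp (A' + c1' * r) / p * (2 * p) * (exp (c3' * r) * p)))"
      using p by (intro mult4) auto
    also have "1 / p\<^sup>2 * (exp (A' + c1' * r) / p * (2 * p) * (exp (c3' * r) * p))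
        = 2 / p * (exp (A' + c1' * r) * exp (c3' * r))"
      using p by (simp add: power2_eq_square)
    also have "exp (A' + c1' * r) * exp (c3' * r) = exp (A' + (c1' + c3') * r)"
      by (simp add: algebra_simps flip: exp_add)
    finally show ?thesis .
  qed

  \<comment> \<open>with this weight the bound on the contribution of the inverse normaliser is \<open>exp (- \<xi>)\<close>\<close>
  define t where "t = exp (\<xi> + A' + (c1' + c3') * r) / p"
  have t: "0 < t" using p by (simp add: t_def)
  have "(\<integral>\<^sup>+\<omega>. emeasure (posterior \<pi> T lam \<beta> (X \<omega>)) ?C \<partial>N)
      \<le> (\<integral>\<^sup>+\<omega>. ennreal (t / 2) * ?num \<omega> + ennreal (1 / (2 * t)) * ennreal (1 / ?D \<omega>) \<partial>N)"
    using t by (intro nn_integral_mono emeasure_posterior_le) auto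
  also have "\<dots> = ennreal (t / 2) * (\<integral>\<^sup>+\<omega>. ?num \<omega> \<partial>N)
      + ennreal (1 / (2 * t)) * (\<integral>\<^sup>+\<omega>. ennreal (1 / ?D \<omega>) \<partial>N)"
    by (simp add: nn_integral_add nn_integral_cmult)
  also have "\<dots> \<le> ennreal (t / 2) * ennreal (4 * p * exp (A + c1 * r - \<gamma> * r * (1 + 2^n)))
      + ennreal (1 / (2 * t)) * ennreal (2 / p * exp (A' + (c1' + c3') * r))"
    by (intro add_mono mult_left_mono num inv) auto
  also have "\<dots> = ennreal (t / 2 * (4 * p * exp (A + c1 * r - \<gamma> * r * (1 + 2^n)))
      + 1 / (2 * t) * (2 / p * exp (A' + (c1' + c3') * r)))"
    using t p by (simp add: ennreal_mult'[symmetric] ennreal_plus[symmetric] del: ennreal_plus)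
  also have "\<dots> \<le> ennreal (2 * exp (- \<xi>))"
  proof (rule ennreal_leI)
    have "1 / (2 * t) * (2 / p * exp (A' + (c1' + c3') * r))
        = exp (A' + (c1' + c3') * r) / exp (\<xi> + A' + (c1' + c3') * r)"
      using p by (simp add: t_def)
    also have "\<dots> = exp (- \<xi>)" by (simp flip: exp_diff)
    finally have 1: "1 / (2 * t) * (2 / p * exp (A' + (c1' + c3') * r)) = exp (- \<xi>)" .
    have "t / 2 * (4 * p * exp (A + c1 * r - \<gamma> * r * (1 + 2^n)))
        = 2 * (exp (\<xi> + A' + (c1' + c3') * r) * exp (A + c1 * r - \<gamma> * r * (1 + 2^n)))"
      using p by (simp add: t_def)
    also have "\<dots> = 2 * exp (\<xi> + (A + A') + S * r - \<gamma> * r * (1 + 2^n))"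
      by (simp add: S_def algebra_simps flip: exp_add)
    also have "\<dots> \<le> 2 * exp (- \<xi> - 1)"
    proof -
      \<comment> \<open>the radius \<open>2^n * r\<close> beats the terms \<open>S * r\<close> and leaves \<open>- 5 * (\<gamma> * r)\<close>\<close>
      have "\<gamma> * r * (4 + 2 * S / \<gamma>) \<le> \<gamma> * r * 2^n"
        using n one by (intro mult_left_mono) (auto simp: S_def)
      moreover have "\<gamma> * r * (4 + 2 * S / \<gamma>) = 4 * (\<gamma> * r) + 2 * (S * r)"
        using \<gamma> by (simp add: field_simps)
      moreover have "0 \<le> S * r" using c1 c3' r0 by (simp add: S_def)
      ultimately have "\<xi> + (A + A') + S * r - \<gamma> * r * (1 + 2^n) \<le> \<xi> + (A + A') - 5 * (\<gamma> * r)"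
        by (simp add: distrib_left)
      also have "\<dots> \<le> - \<xi> - 1" using \<gamma>r A \<xi> by argo
      finally show ?thesis by simp
    qed
    also have "\<dots> = 2 * exp (-1) * exp (- \<xi>)" by (simp flip: exp_add)
    also have "\<dots> \<le> 1 * exp (- \<xi>)"
    proof (rule mult_right_mono)
      have "2 \<le> exp (1::real)" using exp_ge_add_one_self[of 1] by simp
      then show "2 * exp (-1) \<le> (1::real)" by (simp add: exp_minus field_simps)
    qed simp
    finally show "t / 2 * (4 * p * exp (A + c1 * r - \<gamma> * r * (1 + 2^n)))
      + 1 / (2 * t) * (2 / p * exp (A' + (c1' + c3') * r)) \<le> 2 * exp (- \<xi>)"
      using 1 by simp
  qed
  finally show ?thesis .
qed

end

section \<open>Randomised estimators\<close>

text \<open>The auxiliary variable is independent of the whole original \<open>\<sigma>\<close>-algebra, so the conditional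
  law of the estimator given \<open>X\<close> is also its law given that \<open>\<sigma>\<close>-algebra. Hence its mass may be
  integrated over every event \<open>B\<close> of the latter, not only over those determined by \<open>X\<close>.\<close>

lemma emeasure_randomised_estimator:
  assumes M: "prob_space M" and sub: "subalgebra M F" and X [measurable]: "X \<in> measurable F E"
    and est: "randomised_estimator M F E X \<pi> K S U est"
    and C [measurable]: "C \<in> sets \<pi>" and B: "B \<in> sets F"
    and K: "\<And>\<omega>. \<omega> \<in> space M \<Longrightarrow> prob_space (K (X \<omega>))"
  shows "emeasure M (B \<inter> {\<omega> \<in> space M. est (X \<omega>, U \<omega>) \<in> C}) = (\<integral>\<^sup>+\<omega>\<in>B. emeasure (K (X \<omega>)) C \<partial>M)"
proof -
  interpret prob_space M by (rule M)
  have U [measurable]: "U \<in> measurable M S"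
    and ind: "indep_set (sets F) (sets (vimage_algebra (space M) U S))"
    and e [measurable]: "est \<in> measurable (E \<Otimes>\<^sub>M S) \<pi>"
    and ce: "AE \<omega> in M. real_cond_exp M (vimage_algebra (space M) X E)
          (\<lambda>\<omega>. indicator C (est (X \<omega>, U \<omega>))) \<omega> = measure (K (X \<omega>)) C"
    using est C by (auto simp: randomised_estimator_def)
  have spF: "space F = space M" and setsF: "sets F \<subseteq> sets M"
    using sub by (auto simp: subalgebra_def)
  have [measurable]: "X \<in> measurable M E" by (rule measurable_from_subalg[OF sub X])
  have idF [measurable]: "(\<lambda>\<omega>. \<omega>) \<in> measurable M F"
    using spF setsF by (intro measurableI) (auto simp: Int_absorb2 sets.sets_into_space dest: sets.sets_into_space)
  let ?D = "distr M S U"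
  interpret D: prob_space ?D by (rule prob_space_distr) simp
  define g where "g x = (\<integral>\<^sup>+u. indicator C (est (x, u)) \<partial>?D)" for x
  have g_meas [measurable]: "g \<in> borel_measurable E"
    unfolding g_def by measurable
  have g_le: "g x \<le> 1" for x
  proof -
    have "g x \<le> (\<integral>\<^sup>+u. 1 \<partial>?D)"
      unfolding g_def by (intro nn_integral_mono) (auto split: split_indicator)
    then show ?thesis using D.emeasure_space_1 by simp
  qed
  let ?ev = "{\<omega> \<in> space M. est (X \<omega>, U \<omega>) \<in> C}"
  have ev [measurable]: "?ev \<in> sets M" by measurable

  have joint: "distr M F (\<lambda>\<omega>. \<omega>) \<Otimes>\<^sub>M ?D = distr M (F \<Otimes>\<^sub>M S) (\<lambda>\<omega>. (\<omega>, U \<omega>))"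
  proof (rule pair_measure_eqI)
    interpret DF: prob_space "distr M F (\<lambda>\<omega>. \<omega>)" by (rule prob_space_distr) simp
    show "sigma_finite_measure (distr M F (\<lambda>\<omega>. \<omega>))" ..
    show "sigma_finite_measure ?D" ..
    fix A B' assume "A \<in> sets (distr M F (\<lambda>\<omega>. \<omega>))" "B' \<in> sets ?D"
    then have [measurable]: "A \<in> sets F" "B' \<in> sets S" by auto
    let ?UB = "U -` B' \<inter> space M"
    have A: "A \<subseteq> space M" using sets.sets_into_space[OF \<open>A \<in> sets F\<close>] by (simp add: spF)
    have "?UB \<in> sets (vimage_algebra (space M) U S)" by (rule in_vimage_algebra) simp
    then have "prob (A \<inter> ?UB) = prob A * prob ?UB"
      using indep_setD[OF ind \<open>A \<in> sets F\<close>] by simp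
    then have "emeasure M A * emeasure M ?UB = emeasure M (A \<inter> ?UB)"
      by (simp add: emeasure_eq_measure ennreal_mult')
    moreover have "(\<lambda>\<omega>. (\<omega>, U \<omega>)) -` (A \<times> B') \<inter> space M = A \<inter> ?UB" "A \<inter> space M = A"
      using A by auto
    ultimately show "emeasure (distr M F (\<lambda>\<omega>. \<omega>)) A * emeasure ?D B'
        = emeasure (distr M (F \<Otimes>\<^sub>M S) (\<lambda>\<omega>. (\<omega>, U \<omega>))) (A \<times> B')"
      by (simp add: emeasure_distr)
  qed simp

  \<comment> \<open>given the original \<open>\<sigma>\<close>-algebra, the event has conditional probability \<open>g (X \<omega>)\<close>\<close>
  have cond_F: "emeasure M (A \<inter> ?ev) = (\<integral>\<^sup>+\<omega>\<in>A. g (X \<omega>) \<partial>M)" if A [measurable]: "A \<in> sets F" for A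
  proof -
    let ?h = "\<lambda>z. indicator A (fst z) * indicator C (est (X (fst z), snd z)) :: ennreal"
    have [measurable]: "A \<in> sets M" using A setsF by auto
    have "emeasure M (A \<inter> ?ev) = (\<integral>\<^sup>+\<omega>. indicator (A \<inter> ?ev) \<omega> \<partial>M)"
      by (rule nn_integral_indicator[symmetric]) measurable
    also have "\<dots> = (\<integral>\<^sup>+\<omega>. ?h (\<omega>, U \<omega>) \<partial>M)"
      by (intro nn_integral_cong) (auto split: split_indicator)
    also have "\<dots> = (\<integral>\<^sup>+z. ?h z \<partial>distr M (F \<Otimes>\<^sub>M S) (\<lambda>\<omega>. (\<omega>, U \<omega>)))"
      by (subst nn_integral_distr) measurable
    also have "distr M (F \<Otimes>\<^sub>M S) (\<lambda>\<omega>. (\<omega>, U \<omega>)) = distr M F (\<lambda>\<omega>. \<omega>) \<Otimes>\<^sub>M ?D"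
      by (rule joint[symmetric])
    also have "(\<integral>\<^sup>+z. ?h z \<partial>(distr M F (\<lambda>\<omega>. \<omega>) \<Otimes>\<^sub>M ?D))
        = (\<integral>\<^sup>+\<omega>. (\<integral>\<^sup>+u. ?h (\<omega>, u) \<partial>?D) \<partial>distr M F (\<lambda>\<omega>. \<omega>))"
      by (rule D.nn_integral_fst[symmetric]) measurable
    also have "\<dots> = (\<integral>\<^sup>+\<omega>. (\<integral>\<^sup>+u. ?h (\<omega>, u) \<partial>?D) \<partial>M)"
      by (rule nn_integral_distr) measurable
    also have "\<dots> = (\<integral>\<^sup>+\<omega>\<in>A. g (X \<omega>) \<partial>M)"
      by (intro nn_integral_cong) (auto simp: g_def split: split_indicator)
    finally show ?thesis .
  qed

  let ?X = "vimage_algebra (space M) X E"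
  have subX: "subalgebra M ?X"
    using measurable_sets[OF \<open>X \<in> measurable M E\<close>]
    by (auto simp: subalgebra_def sets_vimage_algebra2 measurable_space[OF \<open>X \<in> measurable M E\<close>])
  interpret FS: finite_measure_subalgebra M ?X
    by (unfold_locales) (rule subX)
  have setsX: "sets ?X \<subseteq> sets F"
    using measurable_sets[OF X]
    by (auto simp: sets_vimage_algebra2 measurable_space[OF \<open>X \<in> measurable M E\<close>] spF)
  have [measurable]: "X \<in> measurable ?X E"
    by (rule measurable_vimage_algebra1) (auto simp: measurable_space[OF \<open>X \<in> measurable M E\<close>])

  have "AE \<omega> in M. real_cond_exp M ?X (\<lambda>\<omega>. indicator C (est (X \<omega>, U \<omega>))) \<omega> = enn2real (g (X \<omega>))"
  proof (rule FS.real_cond_exp_charact)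
    fix A assume A: "A \<in> sets ?X"
    then have "A \<in> sets F" using setsX by auto
    then have [measurable]: "A \<in> sets M" using setsF by auto
    have "(\<integral>\<omega>\<in>A. indicator C (est (X \<omega>, U \<omega>)) \<partial>M) = (\<integral>\<omega>. indicator (A \<inter> ?ev) \<omega> \<partial>M :: real)"
      unfolding set_lebesgue_integral_def
      by (intro Bochner_Integration.integral_cong) (auto split: split_indicator)
    also have "\<dots> = enn2real (emeasure M (A \<inter> ?ev))"
      by (simp add: measure_def)
    also have "\<dots> = enn2real (\<integral>\<^sup>+\<omega>. ennreal (indicator A \<omega> * enn2real (g (X \<omega>))) \<partial>M)"
      unfolding cond_F[OF \<open>A \<in> sets F\<close>]
      using le_less_trans[OF g_le ennreal_one_less_top]
      by (intro arg_cong[where f=enn2real] nn_integral_cong) (auto split: split_indicator)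
    also have "\<dots> = (\<integral>\<omega>. indicator A \<omega> * enn2real (g (X \<omega>)) \<partial>M)"
      by (intro integral_eq_nn_integral[symmetric]) auto
    finally show "(\<integral>\<omega>\<in>A. indicator C (est (X \<omega>, U \<omega>)) \<partial>M) = (\<integral>\<omega>\<in>A. enn2real (g (X \<omega>)) \<partial>M)"
      by (simp add: set_lebesgue_integral_def)
  next
    show "integrable M (\<lambda>\<omega>. indicator C (est (X \<omega>, U \<omega>)) :: real)"
      by (rule integrable_const_bound[of _ 1]) (auto split: split_indicator)
    have "enn2real (g x) \<le> 1" for x
      using enn2real_mono[OF g_le] by simp
    then show "integrable M (\<lambda>\<omega>. enn2real (g (X \<omega>)))"
      by (intro integrable_const_bound[of _ 1]) auto
  qed measurable
  with ce AE_space have AE: "AE \<omega> in M. g (X \<omega>) = emeasure (K (X \<omega>)) C"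
  proof eventually_elim
    case (elim \<omega>)
    interpret K: prob_space "K (X \<omega>)" by (rule K) (rule elim)
    have "enn2real (g (X \<omega>)) = measure (K (X \<omega>)) C" using elim by simp
    then show ?case
      by (metis K.emeasure_eq_measure ennreal_enn2real g_le ennreal_one_less_top le_less_trans)
  qed
  have "emeasure M (B \<inter> ?ev) = (\<integral>\<^sup>+\<omega>\<in>B. g (X \<omega>) \<partial>M)" by (rule cond_F[OF B])
  also have "\<dots> = (\<integral>\<^sup>+\<omega>\<in>B. emeasure (K (X \<omega>)) C \<partial>M)"
    using AE
    by (intro nn_integral_cong_AE) (auto elim!: eventually_mono)
  finally show ?thesis .
qed

section \<open>The posterior concentration bound\<close>

theorem theorem1:
  fixes M F :: "'w measure" and E :: "'e measure" and X :: "'w \<Rightarrow> 'e"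
    and \<pi> :: "'t measure" and l :: "'t \<Rightarrow> 't \<Rightarrow> real" and T :: "'e \<Rightarrow> 't \<Rightarrow> 't \<Rightarrow> real"
    and B :: "'w set" and \<theta>s :: 't and \<xi> lam \<beta> \<gamma> r :: real and J :: int
    and c1 c2 c3 A0 :: "real \<Rightarrow> real \<Rightarrow> real"
  assumes "prob_space M" and "subalgebra M F"
    and "X \<in> measurable F E"
    and "prob_space \<pi>"
    and loss_nonneg: "\<And>\<theta> \<theta>'. \<theta> \<in> space \<pi> \<Longrightarrow> \<theta>' \<in> space \<pi> \<Longrightarrow> 0 \<le> l \<theta> \<theta>'"
    and ball_sets: "\<And>\<theta> \<rho>. \<theta> \<in> space \<pi> \<Longrightarrow> 0 \<le> \<rho> \<Longrightarrow> loss_ball (space \<pi>) l \<theta> \<rho> \<in> sets \<pi>"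
    and T_measurable: "(\<lambda>(x, \<theta>, \<theta>'). T x \<theta> \<theta>') \<in> borel_measurable (E \<Otimes>\<^sub>M (\<pi> \<Otimes>\<^sub>M \<pi>))"
    and T_antisym: "\<And>\<omega> \<theta> \<theta>'. \<omega> \<in> space M \<Longrightarrow> \<theta> \<in> space \<pi> \<Longrightarrow> \<theta>' \<in> space \<pi>
                      \<Longrightarrow> T (X \<omega>) \<theta> \<theta>' = - T (X \<omega>) \<theta>' \<theta>"
    and "\<theta>s \<in> space \<pi>" and "\<xi> > 0" and "lam > 0" and "0 < \<beta>" and "\<beta> < 1"
    and "B \<in> sets F"
    and well_defined: "\<And>\<omega>. \<omega> \<in> space M \<Longrightarrow> posterior_well_defined \<pi> T lam \<beta> (X \<omega>)"
    and "laplace_assumption M X (space \<pi>) l T B \<theta>s lam \<beta> c1 c2 c3 A0"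
    and "\<gamma> = gamma_const c2 c3 lam \<beta>" and "J = J_const c1 c2 c3 lam \<beta>"
    and "r = complexity \<pi> l \<gamma> \<theta>s + (A0_avg A0 lam \<beta> + 1 + \<xi>) / \<gamma>"
  shows "(\<integral>\<^sup>+\<omega>. emeasure (posterior \<pi> T lam \<beta> (X \<omega>))
              (space \<pi> - loss_ball (space \<pi>) l \<theta>s (2 powi J * r)) \<partial>uniform_measure M B)
            \<le> ennreal (2 * exp (- \<xi>)) \<and>
         (\<forall>(S :: 'u measure) U est.
            randomised_estimator M F E X \<pi> (posterior \<pi> T lam \<beta>) S U est \<longrightarrow>
              measure (uniform_measure M B)
                {\<omega> \<in> space M. 2 powi (- J) * l \<theta>s (est (X \<omega>, U \<omega>)) > r} \<le> 2 * exp (- \<xi>) \<and>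
              (measure M B \<ge> 1 - exp (- \<xi>) \<longrightarrow>
                measure M {\<omega> \<in> space M. 2 powi (- J) * l \<theta>s (est (X \<omega>, U \<omega>)) > r}
                  \<le> 3 * exp (- \<xi>)))"
proof -
  note M = assms(1) and sub = assms(2) and X = assms(3) and prior = assms(4)
  note \<theta>s = assms(9) and \<xi> = assms(10) and B = assms(14) and la = assms(16)
  note \<gamma> = assms(17) and J = assms(18) and r = assms(19)
  interpret M: prob_space M by (rule M)
  let ?N = "uniform_measure M B"
  have BM [measurable]: "B \<in> sets M" using B sub by (auto simp: subalgebra_def)
  have XM [measurable]: "X \<in> measurable M E" by (rule measurable_from_subalg[OF sub X])
  have PB: "0 < measure M B" using la by (simp add: laplace_assumption_def)
  have N: "prob_space ?N"
    using PB by (intro prob_space_uniform_measure) (auto simp: M.emeasure_eq_measure)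
  have \<gamma>_pos: "0 < \<gamma>" using la by (auto simp: \<gamma> gamma_const_def laplace_assumption_def)
  have ax: "bayes_test \<pi> ?N E X T lam \<beta>" "centred_prior \<pi> l \<theta>s \<gamma>"
    using prior N XM T_measurable well_defined loss_nonneg ball_sets \<theta>s \<gamma>_pos
    by (auto simp: bayes_test_def bayes_test_axioms_def centred_prior_def centred_prior_axioms_def)
  interpret centred_bayes_test \<pi> ?N E X T lam \<beta> l \<theta>s \<gamma>
    using ax by (rule centred_bayes_test.intro)

  let ?a = "c1 lam \<beta> + c1 lam (2 - \<beta>) + c3 lam (2 - \<beta>)"
  define q where "q = 1 + ?a / (2 * \<gamma>)"
  define n where "n = nat J"
  have a: "0 \<le> ?a" using la by (auto simp: laplace_assumption_def)
  then have q: "1 \<le> q" using \<gamma>_pos by (simp add: q_def)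
  have Jq: "J = 2 + \<lceil>log 2 q\<rceil>" by (simp add: J J_const_def q_def \<gamma> add.commute)
  have "0 \<le> log 2 q" using q by simp
  then have "0 \<le> \<lceil>log 2 q\<rceil>" by linarith
  then have Jn: "J = int n" by (simp add: n_def Jq)
  have powJ: "2 powi J = (2::real)^n" "2 powi (- J) = 1 / (2::real)^n"
    by (simp_all add: Jn power_int_minus inverse_eq_divide)
  have "4 * q = 2 powr (2 + log 2 q)"
    using q by (simp add: powr_add)
  also have "\<dots> \<le> 2 powr (real n)"
  proof (rule powr_mono)
    have "log 2 q \<le> of_int \<lceil>log 2 q\<rceil>" by simp
    moreover have "real n = 2 + of_int \<lceil>log 2 q\<rceil>" using Jn Jq by simp
    ultimately show "2 + log 2 q \<le> real n" by simp
  qed simp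
  finally have n: "4 + 2 * ?a / \<gamma> \<le> 2^n"
    using \<gamma>_pos by (simp add: powr_realpow q_def field_simps)

  let ?C = "space \<pi> - loss_ball (space \<pi>) l \<theta>s (2 powi J * r)"
  let ?K = "posterior \<pi> T lam \<beta>"
  have bound: "(\<integral>\<^sup>+\<omega>. emeasure (?K (X \<omega>)) ?C \<partial>?N) \<le> ennreal (2 * exp (- \<xi>))"
    unfolding powJ
  proof (rule expected_posterior_tail_le[OF _ _ _ _ _ _ _ _ _ _ \<xi> _ n])
    show "r = complexity \<pi> l \<gamma> \<theta>s + ((A0 lam \<beta> + A0 lam (2 - \<beta>)) / 2 + 1 + \<xi>) / \<gamma>"
      by (simp add: r A0_avg_def)
    show "3 * \<gamma> \<le> c2 lam \<beta>" "3 * \<gamma> \<le> c2 lam (2 - \<beta>)" "3 * \<gamma> \<le> - c3 lam \<beta>"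
      using la by (auto simp: \<gamma> gamma_const_def laplace_assumption_def)
  qed (use la in \<open>auto simp: laplace_assumption_def laplace_def\<close>)

  have est: "measure ?N {\<omega> \<in> space M. 2 powi (- J) * l \<theta>s (est (X \<omega>, U \<omega>)) > r} \<le> 2 * exp (- \<xi>) \<and>
      (measure M B \<ge> 1 - exp (- \<xi>) \<longrightarrow>
        measure M {\<omega> \<in> space M. 2 powi (- J) * l \<theta>s (est (X \<omega>, U \<omega>)) > r} \<le> 3 * exp (- \<xi>))"
    (is "measure _ ?ev \<le> _ \<and> _")
    if re: "randomised_estimator M F E X \<pi> ?K S U est" for S :: "'u measure" and U est
  proof -
    have [measurable]: "U \<in> measurable M S" "est \<in> measurable (E \<Otimes>\<^sub>M S) \<pi>"
      using re by (auto simp: randomised_estimator_def)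
    have est_meas [measurable]: "(\<lambda>\<omega>. est (X \<omega>, U \<omega>)) \<in> measurable M \<pi>" by measurable
    have ev: "?ev = {\<omega> \<in> space M. est (X \<omega>, U \<omega>) \<in> ?C}"
      using measurable_space[OF est_meas] unfolding powJ
      by (auto simp: loss_ball_def field_simps)
    have evM [measurable]: "?ev \<in> sets M" unfolding ev by measurable
    have "emeasure ?N ?ev = emeasure M (B \<inter> ?ev) / emeasure M B"
      by simp
    also have "emeasure M (B \<inter> ?ev) = (\<integral>\<^sup>+\<omega>\<in>B. emeasure (?K (X \<omega>)) ?C \<partial>M)"
      unfolding ev by (rule emeasure_randomised_estimator[OF M sub X re _ B])
        (simp_all add: prob_space_posterior)
    also have "\<dots> / emeasure M B = (\<integral>\<^sup>+\<omega>. emeasure (?K (X \<omega>)) ?C \<partial>?N)"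
    proof (rule nn_integral_uniform_measure[symmetric])
      have "?C \<in> sets \<pi>" by measurable
      from emeasure_posterior_measurable[OF this]
      show "(\<lambda>\<omega>. emeasure (?K (X \<omega>)) ?C) \<in> borel_measurable M" by simp
    qed simp
    finally have "ennreal (measure ?N ?ev) \<le> ennreal (2 * exp (- \<xi>))"
      using bound by (simp add: sample.emeasure_eq_measure)
    then have 1: "measure ?N ?ev \<le> 2 * exp (- \<xi>)" by simp
    have 2: "measure M ?ev \<le> 3 * exp (- \<xi>)" if "measure M B \<ge> 1 - exp (- \<xi>)"
    proof -
      have "measure M ?ev \<le> measure M ((B \<inter> ?ev) \<union> (space M - B))"
        by (intro M.finite_measure_mono) auto
      also have "\<dots> \<le> measure M (B \<inter> ?ev) + measure M (space M - B)"
        by (intro measure_Un_le) auto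
      also have "measure M (space M - B) \<le> exp (- \<xi>)" using that by (simp add: M.prob_compl)
      also have "measure M (B \<inter> ?ev) = measure M B * measure ?N ?ev"
        using PB by (subst measure_uniform_measure) (auto simp: M.emeasure_eq_measure)
      also have "\<dots> \<le> measure ?N ?ev" by (simp add: mult_left_le_one_le)
      finally show ?thesis using 1 by simp
    qed
    show ?thesis using 1 2 by blast
  qed
  show ?thesis
    by (intro conjI[OF bound] allI impI) (rule est)
qed

end
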